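(* There is a computable, atomic measure $\mu$ on $2^\omega$ such that (i) every $X\in\mathrm{MLR}_\mu\setminus\mathrm{Atoms}_\mu$ is complex, and (ii) there is no computable, continuous measure $\nu$ with $\mathrm{MLR}_\mu\setminus\mathrm{Atoms}_\mu\subseteq\mathrm{MLR}_\nu$.
   Context: All measures are Borel probability measures on Cantor space $2^\omega$. A measure $\mu$ is computable if $\sigma\mapsto\mu(\{X:\sigma\prec X\})$ is a computable real-valued function on finite binary strings. $\mathrm{Atoms}_\mu=\{X\in 2^\omega:\mu(\{X\})>0\}$; $\mu$ is atomic if $\mathrm{Atoms}_\mu\ne\emptyset$ and continuous otherwise. A $\mu$-Martin-Löf test is a uniformly $\Sigma^0_1$ sequence $(\mathcal U_i)_{i\in\omega}$ with $\mu(\mathcal U_i)\le 2^{-i}$; $\mathrm{MLR}_\mu$ is the set of $X$ with $X\notin\bigcap_i\mathcal U_i$ for every such test. $\mathrm K$ is prefix-free Kolmogorov complexity; an order is a non-decreasing unbounded function $f:\omega\to\omega$ with $f(0)=0$; $X$ is complex if there is a computable order $f$ with $\mathrm K(X\upharpoonright n)\ge f(n)$ for all $n$, where $X\upharpoonright n$ is the initial segment of $X$ of length $n$. *)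

theory Defs
  imports "HOL-Probability.Probability" "HOL-Library.Sublist" "HOL-Library.Nat_Bijection"
begin

section \<open>Computability on the natural numbers\<close>

text \<open>
  Kleene's unbounded search: the least \<open>n\<close> with \<open>f (a, n) = 0\<close>, undefined if there is none
  or if \<open>f (a, k)\<close> diverges for some smaller \<open>k\<close>.
\<close>

definition mu_search :: "(nat \<rightharpoonup> nat) \<Rightarrow> (nat \<rightharpoonup> nat)" where
  "mu_search f a =
     (let P = (\<lambda>n. f (prod_encode (a, n)) = Some 0 \<and> (\<forall>k<n. f (prod_encode (a, k)) \<noteq> None))
      in if \<exists>n. P n then Some (LEAST n. P n) else None)"

text \<open>
  The partial recursive functions. All functions are unary; several arguments are passed through
  the Cantor pairing function \<open>prod_encode\<close>. In the scheme of primitive recursion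
  \<open>h (a, 0) = f a\<close> and \<open>h (a, Suc y) = g (a, y, h (a, y))\<close>.
\<close>

inductive partrec :: "(nat \<rightharpoonup> nat) \<Rightarrow> bool" where
  zero: "partrec (\<lambda>_. Some 0)"
| succ: "partrec (\<lambda>n. Some (Suc n))"
| left: "partrec (\<lambda>n. Some (fst (prod_decode n)))"
| right: "partrec (\<lambda>n. Some (snd (prod_decode n)))"
| pair: "partrec f \<Longrightarrow> partrec g \<Longrightarrow>
    partrec (\<lambda>n. Option.bind (f n) (\<lambda>a. Option.bind (g n) (\<lambda>b. Some (prod_encode (a, b)))))"
| comp: "partrec f \<Longrightarrow> partrec g \<Longrightarrow> partrec (f \<circ>\<^sub>m g)"
| prim_rec: "partrec f \<Longrightarrow> partrec g \<Longrightarrow>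
    partrec (\<lambda>n. case prod_decode n of (a, m) \<Rightarrow>
      rec_nat (f a)
        (\<lambda>y r. Option.bind r (\<lambda>v. g (prod_encode (a, prod_encode (y, v))))) m)"
| search: "partrec f \<Longrightarrow> partrec (mu_search f)"

definition computable :: "(nat \<Rightarrow> nat) \<Rightarrow> bool" where
  "computable f \<longleftrightarrow> partrec (\<lambda>n. Some (f n))"

definition ce_set :: "nat set \<Rightarrow> bool" where
  "ce_set W \<longleftrightarrow> (\<exists>f. partrec f \<and> W = dom f)"

section \<open>Finite binary strings, Cantor space\<close>

type_synonym string2 = "bool list"
type_synonym cantor = "nat \<Rightarrow> bool"

text \<open>Bijective base-2 numeration, least significant digit first.\<close>

fun str_code :: "string2 \<Rightarrow> nat" where
  "str_code [] = 0"
| "str_code (b # bs) = 2 * str_code bs + (if b then 2 else 1)"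

lemma bij_str_code: "bij str_code"
proof (rule bijI)
  show "inj str_code"
  proof (rule injI)
    fix x y show "str_code x = str_code y \<Longrightarrow> x = y"
    proof (induction x arbitrary: y)
      case Nil
      then show ?case by (cases y) (auto split: if_splits)
    next
      case (Cons b bs)
      then obtain c cs where y: "y = c # cs" by (cases y) (auto split: if_splits)
      have eq: "2 * str_code bs + (if b then 2 else 1) = 2 * str_code cs + (if c then 2 else 1)"
        using Cons.prems y by simp
      then have "b = c" by (cases b; cases c) (simp_all, presburger+)
      with eq have "b = c \<and> str_code bs = str_code cs" by simp
      with Cons.IH y show ?case by blast
    qed
  qed
  have "\<exists>x. str_code x = n" for n
  proof (induction n rule: less_induct)
    case (less n)
    show ?case
    proof (cases "n = 0")
      case True
      then have "str_code [] = n" by simp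
      then show ?thesis ..
    next
      case False
      then have "(n - 1) div 2 < n" by linarith
      with less obtain x where x: "str_code x = (n - 1) div 2" by blast
      have "str_code (even n # x) = n"
        using False by (cases "even n") (simp_all add: x, presburger+)
      then show ?thesis ..
    qed
  qed
  then show "surj str_code" unfolding surj_def by (intro allI) (simp add: eq_commute)
qed

text \<open>Cantor space carries the product topology of the discrete space \<^typ>\<open>bool\<close>.\<close>

definition restr :: "cantor \<Rightarrow> nat \<Rightarrow> string2"  (infix \<open>\<restriction>\<close> 80) where
  "X \<restriction> n = map X [0..<n]"

definition cyl :: "string2 \<Rightarrow> cantor set" where
  "cyl \<sigma> = {X. X \<restriction> length \<sigma> = \<sigma>}"

lemma open_cyl: "open (cyl \<sigma>)"
proof -
  have "open {X :: cantor. X i = b}" for i b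
  proof -
    have "open ((\<lambda>X :: cantor. X i) -` {b})"
      by (intro open_vimage Topological_Spaces.open_discrete continuous_on_product_coordinates)
    moreover have "(\<lambda>X :: cantor. X i) -` {b} = {X. X i = b}" by blast
    ultimately show ?thesis by simp
  qed
  then have "open (\<Inter>i\<in>{..<length \<sigma>}. {X :: cantor. X i = \<sigma> ! i})"
    by (intro open_INT finite_lessThan ballI)
  moreover have "cyl \<sigma> = (\<Inter>i\<in>{..<length \<sigma>}. {X. X i = \<sigma> ! i})"
    unfolding cyl_def restr_def list_eq_iff_nth_eq by auto
  ultimately show ?thesis by simp
qed

section \<open>Computable measures\<close>

definition borel_prob :: "cantor measure \<Rightarrow> bool" where
  "borel_prob \<mu> \<longleftrightarrow> prob_space \<mu> \<and> sets \<mu> = sets borel"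

definition real_of_code :: "nat \<Rightarrow> real" where
  "real_of_code c = (case prod_decode c of (p, q) \<Rightarrow> of_int (int_decode p) / real (Suc q))"

text \<open>
  A real-valued function on strings is computable if rational approximations of its values to
  within \<open>2\<^sup>-\<^sup>n\<close> can be computed uniformly in the string and in \<open>n\<close>.
\<close>

definition computable_real_fun :: "(string2 \<Rightarrow> real) \<Rightarrow> bool" where
  "computable_real_fun r \<longleftrightarrow>
     (\<exists>q. computable q \<and>
       (\<forall>\<sigma> n. \<bar>real_of_code (q (prod_encode (str_code \<sigma>, n))) - r \<sigma>\<bar> \<le> (1 / 2) ^ n))"

definition computable_measure :: "cantor measure \<Rightarrow> bool" where
  "computable_measure \<mu> \<longleftrightarrow> computable_real_fun (\<lambda>\<sigma>. measure \<mu> (cyl \<sigma>))"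

definition Atoms :: "cantor measure \<Rightarrow> cantor set" where
  "Atoms \<mu> = {X. measure \<mu> {X} > 0}"

definition atomic_measure :: "cantor measure \<Rightarrow> bool" where
  "atomic_measure \<mu> \<longleftrightarrow> Atoms \<mu> \<noteq> {}"

definition continuous_measure :: "cantor measure \<Rightarrow> bool" where
  "continuous_measure \<mu> \<longleftrightarrow> \<not> atomic_measure \<mu>"

section \<open>Martin-Loef randomness\<close>

definition uniformly_Sigma01 :: "(nat \<Rightarrow> cantor set) \<Rightarrow> bool" where
  "uniformly_Sigma01 U \<longleftrightarrow>
     (\<exists>W. ce_set W \<and> (\<forall>i. U i = (\<Union>\<sigma>\<in>{\<sigma>. prod_encode (i, str_code \<sigma>) \<in> W}. cyl \<sigma>)))"

definition martin_loef_test :: "cantor measure \<Rightarrow> (nat \<Rightarrow> cantor set) \<Rightarrow> bool" where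
  "martin_loef_test \<mu> U \<longleftrightarrow> uniformly_Sigma01 U \<and> (\<forall>i. measure \<mu> (U i) \<le> (1 / 2) ^ i)"

definition MLR :: "cantor measure \<Rightarrow> cantor set" where
  "MLR \<mu> = {X. \<forall>U. martin_loef_test \<mu> U \<longrightarrow> X \<notin> (\<Inter>i. U i)}"

section \<open>Prefix-free Kolmogorov complexity\<close>

definition prefix_free_machine :: "(string2 \<rightharpoonup> string2) \<Rightarrow> bool" where
  "prefix_free_machine M \<longleftrightarrow>
     (\<exists>f. partrec f \<and> (\<forall>\<sigma>. f (str_code \<sigma>) = map_option str_code (M \<sigma>))) \<and>
     (\<forall>\<sigma>\<in>dom M. \<forall>\<tau>\<in>dom M. prefix \<sigma> \<tau> \<longrightarrow> \<sigma> = \<tau>)"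

definition universal_pf_machine :: "(string2 \<rightharpoonup> string2) \<Rightarrow> bool" where
  "universal_pf_machine U \<longleftrightarrow> prefix_free_machine U \<and>
     (\<forall>M. prefix_free_machine M \<longrightarrow> (\<exists>\<rho>. \<forall>\<tau>. U (\<rho> @ \<tau>) = M \<tau>))"

text \<open>As usual, one universal prefix-free machine is fixed once and for all.\<close>

definition univ_machine :: "string2 \<rightharpoonup> string2" where
  "univ_machine = (SOME U. universal_pf_machine U)"

definition K :: "string2 \<Rightarrow> nat" where
  "K \<sigma> = (LEAST n. \<exists>\<tau>. length \<tau> = n \<and> univ_machine \<tau> = Some \<sigma>)"

definition order_fun :: "(nat \<Rightarrow> nat) \<Rightarrow> bool" where
  "order_fun f \<longleftrightarrow> mono f \<and> (\<forall>m. \<exists>n. m \<le> f n) \<and> f 0 = 0"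

definition complex_seq :: "cantor \<Rightarrow> bool" where
  "complex_seq X \<longleftrightarrow> (\<exists>f. computable f \<and> order_fun f \<and> (\<forall>n. f n \<le> K (X \<restriction> n)))"

end

theory Submission
  imports Defs
begin

text \<open>
  The measure gives the cone above \<open>0\<^sup>e1\<close> the mass \<open>2\<^sup>-\<^sup>e\<^sup>-\<^sup>1\<close> and tosses fair coins inside it at the
  split positions of \<open>e\<close> only, all other bits being \<open>0\<close>. The \<open>k\<close>-th split waits until program \<open>e\<close>
  is seen to halt on input \<open>k\<close> and is then made beyond the output. If \<open>e\<close> is total, its splits
  form an infinite decidable set, so the random sequences of the cone have complexity at least the
  number of splits passed, up to a constant, and are complex. If not, there are finitely many
  splits and every sequence that survives in the cone is an atom.

  For a computable continuous \<open>\<nu>\<close>, compactness gives a computable \<open>g\<close> such that strings of length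
  \<open>g k\<close> have \<open>\<nu>\<close>-measure at most \<open>4\<^sup>-\<^sup>k\<close>. If \<open>e\<close> computes \<open>g\<close>, at most \<open>2\<^sup>k\<close> strings of length
  \<open>g k + e + 1\<close> survive in the cone above \<open>0\<^sup>e1\<close>; they form a \<open>\<nu>\<close>-test that captures the whole cone, including
  its random sequences, none of which is an atom.
\<close>

section \<open>Closure properties of computable functions\<close>

definition pfst :: "nat \<Rightarrow> nat" where "pfst n = fst (prod_decode n)"
definition psnd :: "nat \<Rightarrow> nat" where "psnd n = snd (prod_decode n)"
abbreviation ppair :: "nat \<Rightarrow> nat \<Rightarrow> nat" where "ppair a b \<equiv> prod_encode (a, b)"

lemma pfst_ppair [simp]: "pfst (ppair a b) = a"
  by (simp add: pfst_def)

lemma psnd_ppair [simp]: "psnd (ppair a b) = b"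
  by (simp add: psnd_def)

lemma ppair_collapse [simp]: "ppair (pfst n) (psnd n) = n"
  by (simp add: pfst_def psnd_def)

lemma psnd_le: "psnd n \<le> n"
  by (metis le_prod_encode_2 ppair_collapse)

lemma psnd_0 [simp]: "psnd 0 = 0"
  using psnd_le[of 0] by simp

definition decidable :: "(nat \<Rightarrow> bool) \<Rightarrow> bool" where
  "decidable P \<longleftrightarrow> computable (\<lambda>z. of_bool (P z))"

named_theorems computable_intros

lemma computable_id [computable_intros]: "computable (\<lambda>x. x)"
proof -
  have "partrec (\<lambda>n. Option.bind (Some (fst (prod_decode n)))
      (\<lambda>a. Option.bind (Some (snd (prod_decode n))) (\<lambda>b. Some (prod_encode (a, b)))))"
    by (intro partrec.intros)
  then show ?thesis by (simp add: computable_def)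
qed

lemma computable_comp: "computable f \<Longrightarrow> computable g \<Longrightarrow> computable (\<lambda>x. f (g x))"
  using partrec.comp[of "\<lambda>n. Some (f n)" "\<lambda>n. Some (g n)"]
  by (simp add: computable_def map_comp_def)

lemma computable_Suc [computable_intros]: "computable f \<Longrightarrow> computable (\<lambda>x. Suc (f x))"
  using computable_comp[of Suc f] partrec.succ by (simp add: computable_def)

lemma computable_const [computable_intros]: "computable (\<lambda>x. c)"
proof (induction c)
  case 0
  then show ?case using partrec.zero by (simp add: computable_def)
qed (rule computable_Suc)

lemma computable_pfst [computable_intros]: "computable f \<Longrightarrow> computable (\<lambda>x. pfst (f x))"
  using computable_comp[of pfst f] partrec.left by (simp add: computable_def pfst_def)

lemma computable_psnd [computable_intros]: "computable f \<Longrightarrow> computable (\<lambda>x. psnd (f x))"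
  using computable_comp[of psnd f] partrec.right by (simp add: computable_def psnd_def)

lemma computable_ppair [computable_intros]:
  "computable f \<Longrightarrow> computable g \<Longrightarrow> computable (\<lambda>x. ppair (f x) (g x))"
  using partrec.pair[of "\<lambda>n. Some (f n)" "\<lambda>n. Some (g n)"] by (simp add: computable_def)

text \<open>All parts of the recursion are total, so the option-valued recursion of
  \<open>partrec\<close> never meets \<open>None\<close>. The step \<open>g\<close> appears in
  uncurried form because \<open>computable\<close> speaks of unary functions.\<close>

lemma computable_rec [computable_intros]:
  assumes "computable f" "computable (\<lambda>z. g (pfst z) (pfst (psnd z)) (psnd (psnd z)))"
    "computable h"
  shows "computable (\<lambda>x. rec_nat (f x) (g x) (h x))"
proof -
  let ?G = "\<lambda>z. g (pfst z) (pfst (psnd z)) (psnd (psnd z))"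
  have "rec_nat (Some (f a)) (\<lambda>y r. Option.bind r (\<lambda>v. Some (?G (ppair a (ppair y v))))) m
      = Some (rec_nat (f a) (g a) m)" for a m
    by (induction m) auto
  then have "computable (\<lambda>n. rec_nat (f (pfst n)) (g (pfst n)) (psnd n))"
    using partrec.prim_rec[of "\<lambda>n. Some (f n)" "\<lambda>n. Some (?G n)"] assms(1,2)
    unfolding computable_def by (simp add: case_prod_beta pfst_def[symmetric] psnd_def[symmetric])
  from computable_comp[OF this computable_ppair[OF computable_id assms(3)]]
  show ?thesis by simp
qed

lemma computable_add [computable_intros]:
  assumes "computable f" "computable g" shows "computable (\<lambda>x. f x + g x)"
proof -
  \<comment> \<open>The equations \<open>eq\<close> here and below recast an operation as a
    recursion to which \<open>computable_rec\<close> applies.\<close>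
  have eq: "m + n = rec_nat m (\<lambda>_ r. Suc r) n" for m n :: nat
    by (induction n) auto
  show ?thesis unfolding eq by (intro computable_intros assms)
qed

lemma computable_mult [computable_intros]:
  assumes "computable f" "computable g" shows "computable (\<lambda>x. f x * g x)"
proof -
  have eq: "m * n = rec_nat 0 (\<lambda>_ r. r + m) n" for m n :: nat
    by (induction n) auto
  show ?thesis unfolding eq by (intro computable_intros assms computable_comp[OF assms(1)])
qed

lemma computable_power [computable_intros]:
  assumes "computable f" "computable g" shows "computable (\<lambda>x. f x ^ g x)"
proof -
  have eq: "m ^ n = rec_nat 1 (\<lambda>_ r. r * m) n" for m n :: nat
    by (induction n) auto
  show ?thesis unfolding eq by (intro computable_intros assms computable_comp[OF assms(1)])
qed

lemma computable_pred:
  assumes "computable f" shows "computable (\<lambda>x. f x - 1)"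
proof -
  have eq: "m - 1 = rec_nat 0 (\<lambda>k _. k) m" for m :: nat
    by (cases m) auto
  show ?thesis unfolding eq by (intro computable_intros assms)
qed

lemma computable_diff [computable_intros]:
  assumes "computable f" "computable g" shows "computable (\<lambda>x. f x - g x)"
proof -
  \<comment> \<open>Stated for \<open>f x - g x\<close> only: a general equation for
    \<open>m - n\<close> would also rewrite the \<open>r - 1\<close> on its right-hand side.\<close>
  have eq: "f x - g x = rec_nat (f x) (\<lambda>_ r. r - 1) (g x)" for x
  proof -
    have "m - n = rec_nat m (\<lambda>_ r. r - 1) n" for m n :: nat
      by (induction n) auto
    then show ?thesis .
  qed
  show ?thesis unfolding eq by (intro computable_intros computable_pred assms)
qed

lemma computable_if [computable_intros]:
  assumes "decidable P" "computable f" "computable g"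
  shows "computable (\<lambda>x. if P x then f x else g x)"
proof -
  \<comment> \<open>A case distinction is a recursion of length 0 or 1.\<close>
  have eq: "(if P x then f x else g x) = rec_nat (g x) (\<lambda>_ _. f x) (of_bool (P x))" for x
    by simp
  show ?thesis unfolding eq
    by (intro computable_intros assms assms(1)[unfolded decidable_def] computable_comp[OF assms(2)])
qed

lemma decidable_const [computable_intros]: "decidable (\<lambda>x. c)"
  unfolding decidable_def by (rule computable_const)

lemma decidable_comp: "decidable P \<Longrightarrow> computable f \<Longrightarrow> decidable (\<lambda>x. P (f x))"
  unfolding decidable_def by (rule computable_comp)

lemma decidable_not [computable_intros]: assumes "decidable P" shows "decidable (\<lambda>x. \<not> P x)"
proof -
  have eq: "of_bool (\<not> P x) = (if P x then 0 else 1 :: nat)" for x by simp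
  show ?thesis unfolding decidable_def eq by (intro computable_intros assms)
qed

lemma decidable_conj [computable_intros]: assumes "decidable P" "decidable Q" shows "decidable (\<lambda>x. P x \<and> Q x)"
proof -
  have "of_bool (P x \<and> Q x) = (of_bool (P x) * of_bool (Q x) :: nat)" for x by simp
  then show ?thesis using assms computable_mult unfolding decidable_def by simp
qed

lemma decidable_disj [computable_intros]: assumes "decidable P" "decidable Q" shows "decidable (\<lambda>x. P x \<or> Q x)"
  using decidable_not[OF decidable_conj[OF decidable_not decidable_not, OF assms]] by simp

lemma decidable_imp [computable_intros]: assumes "decidable P" "decidable Q" shows "decidable (\<lambda>x. P x \<longrightarrow> Q x)"
  unfolding imp_conv_disj by (intro computable_intros assms)

lemma decidable_le [computable_intros]: assumes "computable f" "computable g" shows "decidable (\<lambda>x. f x \<le> g x)"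
proof -
  have eq: "of_bool (f x \<le> g x) = 1 - (f x - g x)" for x by (simp add: of_bool_def)
  show ?thesis unfolding decidable_def eq by (intro computable_intros assms)
qed

lemma decidable_less [computable_intros]: assumes "computable f" "computable g" shows "decidable (\<lambda>x. f x < g x)"
  unfolding not_le[symmetric] by (intro computable_intros assms)

lemma decidable_eq [computable_intros]: assumes "computable f" "computable g" shows "decidable (\<lambda>x. f x = g x)"
  unfolding order_eq_iff by (intro computable_intros assms)

lemma decidable_ex_less [computable_intros]:
  assumes "decidable (\<lambda>z. P (pfst z) (psnd z))" "computable h"
  shows "decidable (\<lambda>x. \<exists>k<h x. P x k)"
proof -
  have eq: "of_bool (\<exists>k<m. P x k) = rec_nat 0 (\<lambda>k r. if P x k then 1 else r) m" for x m
  proof (induction m)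
    case (Suc m)
    have "(\<exists>k<Suc m. P x k) \<longleftrightarrow> P x m \<or> (\<exists>k<m. P x k)"
      by (auto simp: less_Suc_eq)
    with Suc show ?case by auto
  qed auto
  \<comment> \<open>The recursion step sees parameter, counter and previous value in one code;
    \<open>P\<close> is reindexed to the first two.\<close>
  have "computable (\<lambda>z. ppair (pfst z) (pfst (psnd z)))"
    by (intro computable_intros)
  from decidable_comp[OF assms(1) this] have P: "decidable (\<lambda>z. P (pfst z) (pfst (psnd z)))"
    by simp
  show ?thesis unfolding decidable_def eq by (intro computable_intros assms(2) P)
qed

lemma decidable_all_less [computable_intros]:
  assumes "decidable (\<lambda>z. P (pfst z) (psnd z))" "computable h"
  shows "decidable (\<lambda>x. \<forall>k<h x. P x k)"
  using decidable_not[OF decidable_ex_less[OF decidable_not[OF assms(1)] assms(2)]] by simp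

section \<open>Unbounded search and computably enumerable sets\<close>

lemma partrec_Least:
  assumes "decidable (\<lambda>z. A (pfst z) (psnd z))"
  shows "partrec (\<lambda>n. if \<exists>s. A n s then Some (LEAST s. A n s) else None)"
proof -
  have "computable (\<lambda>z. of_bool (\<not> A (pfst z) (psnd z)))"
    using decidable_not[OF assms] by (simp add: decidable_def)
  then have "partrec (mu_search (\<lambda>z. Some (of_bool (\<not> A (pfst z) (psnd z)))))"
    unfolding computable_def by (rule partrec.search)
  \<comment> \<open>The searched function is total, so its first zero is exactly the least
    witness.\<close>
  moreover have "mu_search (\<lambda>z. Some (of_bool (\<not> A (pfst z) (psnd z))))
      = (\<lambda>n. if \<exists>s. A n s then Some (LEAST s. A n s) else None)"
    by (auto simp: mu_search_def fun_eq_iff Let_def)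
  ultimately show ?thesis by simp
qed

lemma partrec_search:
  assumes "decidable (\<lambda>z. A (pfst z) (psnd z))" "computable (\<lambda>z. g (pfst z) (psnd z))"
  shows "partrec (\<lambda>n. if \<exists>s. A n s then Some (g n (LEAST s. A n s)) else None)"
proof -
  have "partrec (\<lambda>n. Option.bind (Some n) (\<lambda>a. Option.bind (if \<exists>s. A n s then Some (LEAST s. A n s) else None)
      (\<lambda>b. Some (ppair a b))))"
    using computable_id partrec_Least[OF assms(1)] unfolding computable_def by (rule partrec.pair)
  from partrec.comp[OF assms(2)[unfolded computable_def] this]
  have "partrec ((\<lambda>n. Some (g (pfst n) (psnd n))) \<circ>\<^sub>m (\<lambda>n. Option.bind (Some n)
      (\<lambda>a. Option.bind (if \<exists>s. A n s then Some (LEAST s. A n s) else None) (\<lambda>b. Some (ppair a b)))))" .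
  moreover have "\<dots> = (\<lambda>n. if \<exists>s. A n s then Some (g n (LEAST s. A n s)) else None)"
    by (auto simp: map_comp_def fun_eq_iff)
  ultimately show ?thesis by simp
qed

lemma computable_Least:
  assumes "decidable (\<lambda>z. A (pfst z) (psnd z))" "\<And>n. \<exists>s. A n s"
  shows "computable (\<lambda>n. LEAST s. A n s)"
  using partrec_Least[OF assms(1)] assms(2) by (simp add: computable_def)

text \<open>A projection of a decidable relation is the domain of the search for a witness.\<close>

lemma ce_set_ex:
  assumes "decidable (\<lambda>z. A (pfst z) (psnd z))"
  shows "ce_set {n. \<exists>s. A n s}"
  unfolding ce_set_def
  by (intro exI[of _ "\<lambda>n. if \<exists>s. A n s then Some (LEAST s. A n s) else None"] conjI
      partrec_Least assms) (auto split: if_splits)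

lemma ce_set_dec: "decidable P \<Longrightarrow> ce_set {n. P n}"
  using ce_set_ex[of "\<lambda>n s. P n", OF decidable_comp[OF _ computable_pfst[OF computable_id]]] by simp

section \<open>Kleene's normal form theorem\<close>

definition fact3 :: "nat \<Rightarrow> nat \<Rightarrow> nat \<Rightarrow> nat" where
  "fact3 p x y = ppair p (ppair x y)"

lemma fact3_simps [simp]:
  "pfst (fact3 p x y) = p" "pfst (psnd (fact3 p x y)) = x" "psnd (psnd (fact3 p x y)) = y"
  by (simp_all add: fact3_def)

lemma le_fact3_3: "y \<le> fact3 p x y"
  unfolding fact3_def by (rule order_trans[OF le_prod_encode_2 le_prod_encode_2])

lemma computable_fact3 [computable_intros]:
  "computable f \<Longrightarrow> computable g \<Longrightarrow> computable h \<Longrightarrow> computable (\<lambda>x. fact3 (f x) (g x) (h x))"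
  unfolding fact3_def by (intro computable_intros)

text \<open>
  A program is \<open>\<langle>t, \<langle>l, r\<rangle>\<rangle>\<close>, where the tag \<open>t\<close> is the index of a clause of \<^const>\<open>partrec\<close> and \<open>l\<close>, \<open>r\<close>
  are its subprograms; primitive recursion takes two clauses below. \<open>D p x y\<close> stands for
  ``\<open>p\<close> is known to map \<open>x\<close> to \<open>y\<close>''.
\<close>

definition derives :: "(nat \<Rightarrow> nat \<Rightarrow> nat \<Rightarrow> bool) \<Rightarrow> nat \<Rightarrow> nat \<Rightarrow> nat \<Rightarrow> nat \<Rightarrow> nat \<Rightarrow> nat \<Rightarrow> bool" where
  "derives D p t l r x y \<longleftrightarrow>
     t = 0 \<and> y = 0 \<or>
     t = 1 \<and> y = Suc x \<or>
     t = 2 \<and> y = pfst x \<or>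
     t = 3 \<and> y = psnd x \<or>
     t = 4 \<and> D l x (pfst y) \<and> D r x (psnd y) \<or>
     t = 5 \<and> (\<exists>z. D r x z \<and> D l z y) \<or>
     t = 6 \<and> psnd x = 0 \<and> D l (pfst x) y \<or>
     t = 7 \<and> D l (ppair x y) 0 \<and> (\<forall>k<y. \<exists>z. D l (ppair x k) (Suc z)) \<or>
     t = 6 \<and> 0 < psnd x \<and> (\<exists>v. D p (ppair (pfst x) (psnd x - 1)) v \<and>
        D r (ppair (pfst x) (ppair (psnd x - 1) v)) y)"

definition justified :: "nat set \<Rightarrow> nat \<Rightarrow> bool" where
  "justified D u \<longleftrightarrow> derives (\<lambda>p x y. fact3 p x y \<in> D) (pfst u) (pfst (pfst u))
     (pfst (psnd (pfst u))) (psnd (psnd (pfst u))) (pfst (psnd u)) (psnd (psnd u))"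

lemma derives_mono:
  assumes D: "derives D p t l r x y" and "D \<le> E"
  shows "derives E p t l r x y"
proof -
  have DE: "D p x y \<Longrightarrow> E p x y" for p x y
    using assms(2) by (simp add: le_fun_def)
  from D show ?thesis
    unfolding derives_def by (elim disjE exE conjE; simp add: DE; metis DE)
qed

lemma justified_mono: "justified D u \<Longrightarrow> D \<subseteq> E \<Longrightarrow> justified E u"
  unfolding justified_def by (erule derives_mono) (auto simp: le_fun_def)

text \<open>Every clause draws on finitely many facts. Only for search does their number vary: one
  witness for each \<open>k < y\<close>, besides the zero at \<open>y\<close>.\<close>

lemma derives_finite:
  assumes "derives (\<lambda>p x y. fact3 p x y \<in> D) p t l r x y"
  shows "\<exists>A. finite A \<and> A \<subseteq> D \<and> derives (\<lambda>p x y. fact3 p x y \<in> A) p t l r x y"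
proof -
  from assms consider
      "t = 0 \<and> y = 0 \<or> t = 1 \<and> y = Suc x \<or> t = 2 \<and> y = pfst x \<or> t = 3 \<and> y = psnd x"
    | "t = 4" "fact3 l x (pfst y) \<in> D" "fact3 r x (psnd y) \<in> D"
    | z where "t = 5" "fact3 r x z \<in> D" "fact3 l z y \<in> D"
    | "t = 6" "psnd x = 0" "fact3 l (pfst x) y \<in> D"
    | "t = 7" "fact3 l (ppair x y) 0 \<in> D" "\<forall>k<y. \<exists>z. fact3 l (ppair x k) (Suc z) \<in> D"
    | v where "t = 6" "0 < psnd x" "fact3 p (ppair (pfst x) (psnd x - 1)) v \<in> D"
        "fact3 r (ppair (pfst x) (ppair (psnd x - 1) v)) y \<in> D"
    unfolding derives_def by (elim disjE exE conjE; metis)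
  then show ?thesis
  proof cases
    case 1
    then show ?thesis by (intro exI[of _ "{}"]) (auto simp: derives_def)
  next
    case 2
    then show ?thesis
      by (intro exI[of _ "{fact3 l x (pfst y), fact3 r x (psnd y)}"]) (auto simp: derives_def)
  next
    case 3
    then show ?thesis
      by (intro exI[of _ "{fact3 r x z, fact3 l z y}"]) (auto simp: derives_def)
  next
    case 4
    then show ?thesis
      by (intro exI[of _ "{fact3 l (pfst x) y}"]) (auto simp: derives_def)
  next
    case 5
    then obtain f where f: "\<forall>k<y. fact3 l (ppair x k) (Suc (f k)) \<in> D"
      by metis
    let ?A = "insert (fact3 l (ppair x y) 0) ((\<lambda>k. fact3 l (ppair x k) (Suc (f k))) ` {..<y})"
    have "derives (\<lambda>p x y. fact3 p x y \<in> ?A) p t l r x y"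
      unfolding derives_def using 5(1) by blast
    moreover have "finite ?A" "?A \<subseteq> D" using 5 f by auto
    ultimately show ?thesis by blast
  next
    case 6
    then show ?thesis
      by (intro exI[of _ "{fact3 p (ppair (pfst x) (psnd x - 1)) v,
        fact3 r (ppair (pfst x) (ppair (psnd x - 1) v)) y}"]) (auto simp: derives_def)
  qed
qed

lemma justified_finite: "justified D u \<Longrightarrow> \<exists>A. finite A \<and> A \<subseteq> D \<and> justified A u"
  unfolding justified_def by (rule derives_finite)

text \<open>Lists grow at the head: a fact is justified by the facts behind it.\<close>

fun derivation :: "nat list \<Rightarrow> bool" where
  "derivation [] \<longleftrightarrow> True"
| "derivation (u # us) \<longleftrightarrow> justified (set us) u \<and> derivation us"

definition derivable :: "nat set" where
  "derivable = {u. \<exists>us. derivation us \<and> u \<in> set us}"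

lemma derivation_append: "derivation us \<Longrightarrow> derivation vs \<Longrightarrow> derivation (us @ vs)"
  by (induction us) (auto intro: justified_mono)

lemma derivation_justified: "derivation us \<Longrightarrow> u \<in> set us \<Longrightarrow> justified derivable u"
  by (induction us) (auto simp: derivable_def intro: justified_mono)

lemma derivation_finite:
  assumes "finite A" "A \<subseteq> derivable" shows "\<exists>us. derivation us \<and> A \<subseteq> set us"
  using assms
proof (induction A rule: finite_induct)
  case empty
  show ?case by (intro exI[of _ "[]"]) auto
next
  case (insert u A)
  then obtain us vs where "derivation us" "A \<subseteq> set us" "derivation vs" "u \<in> set vs"
    by (auto simp: derivable_def)
  then show ?case by (intro exI[of _ "us @ vs"]) (auto intro: derivation_append)
qed

text \<open>For the converse, finitely many derivable facts that justify \<open>u\<close> lie in one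
  common derivation, which \<open>u\<close> extends. This fixed point property turns the clauses of
  \<open>derives\<close> into equations for \<open>evaluates\<close>.\<close>

lemma derivable_iff: "u \<in> derivable \<longleftrightarrow> justified derivable u"
proof
  assume "u \<in> derivable"
  then obtain us where "derivation us" "u \<in> set us" unfolding derivable_def by blast
  then show "justified derivable u" by (rule derivation_justified)
next
  assume "justified derivable u"
  then obtain A where A: "finite A" "A \<subseteq> derivable" "justified A u"
    using justified_finite by blast
  with derivation_finite obtain us where "derivation us" "A \<subseteq> set us" by blast
  with A have "derivation (u # us)" by (auto intro: justified_mono)
  then show "u \<in> derivable" unfolding derivable_def by (auto intro!: exI[of _ "u # us"])
qed

definition prog :: "nat \<Rightarrow> nat \<Rightarrow> nat \<Rightarrow> nat" where
  "prog t l r = ppair t (ppair l r)"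

definition evaluates :: "nat \<Rightarrow> nat \<Rightarrow> nat \<Rightarrow> bool" where
  "evaluates p x y \<longleftrightarrow> fact3 p x y \<in> derivable"

lemma evaluates_prog:
  "evaluates (prog t l r) x y \<longleftrightarrow> derives evaluates (prog t l r) t l r x y"
  using derivable_iff[of "fact3 (prog t l r) x y"]
  by (simp add: justified_def evaluates_def[abs_def] prog_def)

text \<open>Induction on \<open>partrec\<close>: each clause unfolds \<open>evaluates_prog\<close>
  at the program with its tag; primitive recursion takes a further induction on the counter.\<close>

lemma evaluates_complete:
  assumes "partrec f" shows "\<exists>p. \<forall>x y. f x = Some y \<longleftrightarrow> evaluates p x y"
  using assms
proof induction
  case zero
  show ?case
    by (intro exI[of _ "prog 0 0 0"], subst evaluates_prog) (auto simp: derives_def)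
next
  case succ
  show ?case
    by (intro exI[of _ "prog 1 0 0"], subst evaluates_prog) (auto simp: derives_def)
next
  case left
  show ?case
    by (intro exI[of _ "prog 2 0 0"], subst evaluates_prog) (auto simp: derives_def pfst_def)
next
  case right
  show ?case
    by (intro exI[of _ "prog 3 0 0"], subst evaluates_prog) (auto simp: derives_def psnd_def)
next
  case (pair f g)
  then obtain p q where pq: "\<And>x y. f x = Some y \<longleftrightarrow> evaluates p x y" "\<And>x y. g x = Some y \<longleftrightarrow> evaluates q x y"
    by metis
  show ?case
    by (intro exI[of _ "prog 4 p q"], subst evaluates_prog)
      (auto simp: derives_def pq[symmetric] bind_eq_Some_conv intro: ppair_collapse)
next
  case (comp f g)
  then obtain p q where pq: "\<And>x y. f x = Some y \<longleftrightarrow> evaluates p x y" "\<And>x y. g x = Some y \<longleftrightarrow> evaluates q x y"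
    by metis
  show ?case
    by (intro exI[of _ "prog 5 p q"], subst evaluates_prog)
      (auto simp: derives_def pq[symmetric] map_comp_Some_iff)
next
  case (prim_rec f g)
  then obtain p q where pq: "\<And>x y. f x = Some y \<longleftrightarrow> evaluates p x y" "\<And>x y. g x = Some y \<longleftrightarrow> evaluates q x y"
    by metis
  let ?R = "\<lambda>a m. rec_nat (f a) (\<lambda>y r. Option.bind r (\<lambda>v. g (ppair a (ppair y v)))) m"
  have "?R a m = Some y \<longleftrightarrow> evaluates (prog 6 p q) (ppair a m) y" for a m y
  proof (induction m arbitrary: y)
    case 0
    show ?case by (subst evaluates_prog) (simp add: derives_def pq)
  next
    case (Suc m)
    show ?case
      by (subst evaluates_prog) (simp add: derives_def bind_eq_Some_conv Suc pq)
  qed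
  from this[of "pfst x" "psnd x" for x] show ?case
    by (intro exI[of _ "prog 6 p q"]) (auto simp: case_prod_beta pfst_def psnd_def)
next
  case (search f)
  then obtain p where p: "\<And>x y. f x = Some y \<longleftrightarrow> evaluates p x y" by metis
  have "mu_search f x = Some y \<longleftrightarrow> evaluates (prog 7 p 0) x y" for x y
  proof -
    let ?P = "\<lambda>n. f (ppair x n) = Some 0 \<and> (\<forall>k<n. f (ppair x k) \<noteq> None)"
    have "evaluates (prog 7 p 0) x y \<longleftrightarrow> f (ppair x y) = Some 0 \<and> (\<forall>k<y. \<exists>z. f (ppair x k) = Some (Suc z))"
      by (subst evaluates_prog) (auto simp: derives_def p)
    \<comment> \<open>When all values below \<open>y\<close> are defined, they are nonzero exactly
      if no smaller \<open>k\<close> satisfies \<open>?P\<close>.\<close>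
    also have "\<dots> \<longleftrightarrow> ?P y \<and> (\<forall>k<y. \<not> ?P k)"
    proof (intro iffI conjI allI impI)
      assume H: "?P y \<and> (\<forall>k<y. \<not> ?P k)"
      fix k assume "k < y"
      with H have "f (ppair x k) \<noteq> None" "f (ppair x k) \<noteq> Some 0"
        by (meson less_trans)+
      then show "\<exists>z. f (ppair x k) = Some (Suc z)"
        by (metis not0_implies_Suc option.exhaust)
    qed auto
    also have "\<dots> \<longleftrightarrow> Ex ?P \<and> (LEAST n. ?P n) = y"
    proof
      assume H: "?P y \<and> (\<forall>k<y. \<not> ?P k)"
      then have "(LEAST n. ?P n) = y" by (intro Least_equality) (blast, meson not_less)
      with H show "Ex ?P \<and> (LEAST n. ?P n) = y" by blast
    next
      assume H: "Ex ?P \<and> (LEAST n. ?P n) = y"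
      then have "?P y" using LeastI_ex[of ?P] by blast
      moreover have "\<forall>k<y. \<not> ?P k" using H not_less_Least[of _ ?P] by blast
      ultimately show "?P y \<and> (\<forall>k<y. \<not> ?P k)" by blast
    qed
    also have "\<dots> \<longleftrightarrow> mu_search f x = Some y"
      by (auto simp: mu_search_def Let_def)
    finally show ?thesis by simp
  qed
  then show ?case by blast
qed

text \<open>
  From here on lists of facts are replaced by their codes under \<^const>\<open>list_encode\<close>, so that being
  a derivation becomes a decidable property of numbers.
\<close>

definition ltl :: "nat \<Rightarrow> nat" where "ltl c = psnd (c - 1)"
definition lhd :: "nat \<Rightarrow> nat" where "lhd c = pfst (c - 1)"
definition ldrop :: "nat \<Rightarrow> nat \<Rightarrow> nat" where "ldrop i c = rec_nat c (\<lambda>_ r. ltl r) i"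
definition lmem :: "nat \<Rightarrow> nat \<Rightarrow> bool" where
  "lmem u c \<longleftrightarrow> (\<exists>i<c. ldrop i c \<noteq> 0 \<and> lhd (ldrop i c) = u)"

lemma ltl_list_encode: "ltl (list_encode us) = list_encode (tl us)"
  by (cases us) (auto simp: ltl_def)

lemma ldrop_list_encode: "ldrop i (list_encode us) = list_encode (drop i us)"
  by (induction i) (auto simp: ldrop_def ltl_list_encode drop_Suc tl_drop)

lemma list_encode_eq_0: "list_encode us = 0 \<longleftrightarrow> us = []"
  by (cases us) auto

lemma lhd_list_encode: "us \<noteq> [] \<Longrightarrow> lhd (list_encode us) = hd us"
  by (cases us) (auto simp: lhd_def)

lemma lhd_ldrop: "i < length us \<Longrightarrow> lhd (list_encode (drop i us)) = us ! i"
  by (subst lhd_list_encode) (auto simp: hd_drop_conv_nth)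

text \<open>This is why the index in \<open>lmem\<close> and \<open>lderivation\<close> may be
  bounded by \<open>c\<close>.\<close>

lemma length_le_list_encode: "length us \<le> list_encode us"
proof (induction us)
  case (Cons u us)
  then show ?case using le_prod_encode_2[of "list_encode us" u] by simp
qed auto

lemma lmem_list_encode: "lmem u (list_encode us) \<longleftrightarrow> u \<in> set us"
proof
  assume "lmem u (list_encode us)"
  then obtain i where i: "drop i us \<noteq> []" "lhd (list_encode (drop i us)) = u"
    unfolding lmem_def ldrop_list_encode list_encode_eq_0 by blast
  then have "hd (drop i us) = u" by (simp only: lhd_list_encode not_False_eq_True)
  with i(1) show "u \<in> set us" using hd_in_set[OF i(1)] set_drop_subset[of i us] by blast
next
  assume "u \<in> set us"
  then obtain i where i: "i < length us" "us ! i = u" by (auto simp: in_set_conv_nth)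
  then have "drop i us \<noteq> []" "hd (drop i us) = u" by (simp_all add: hd_drop_conv_nth)
  then have "lhd (list_encode (drop i us)) = u" by (simp only: lhd_list_encode not_False_eq_True)
  moreover have "i < list_encode us" using i(1) length_le_list_encode[of us] by (rule less_le_trans)
  ultimately show "lmem u (list_encode us)"
    unfolding lmem_def ldrop_list_encode list_encode_eq_0 using \<open>drop i us \<noteq> []\<close> by blast
qed

lemma in_set_less_list_encode: "u \<in> set us \<Longrightarrow> u < list_encode us"
proof (induction us)
  case (Cons v us)
  then show ?case
    using le_prod_encode_2[of "list_encode us" v] le_prod_encode_1[of v "list_encode us"]
    by auto
qed auto

lemma computable_ltl [computable_intros]: "computable f \<Longrightarrow> computable (\<lambda>x. ltl (f x))"
  unfolding ltl_def by (intro computable_intros)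

lemma computable_lhd [computable_intros]: "computable f \<Longrightarrow> computable (\<lambda>x. lhd (f x))"
  unfolding lhd_def by (intro computable_intros)

lemma computable_ldrop [computable_intros]: "computable f \<Longrightarrow> computable g \<Longrightarrow> computable (\<lambda>x. ldrop (f x) (g x))"
  unfolding ldrop_def by (intro computable_intros)

lemma decidable_lmem [computable_intros]:
  assumes "computable f" "computable g" shows "decidable (\<lambda>x. lmem (f x) (g x))"
  unfolding lmem_def
  by (intro computable_intros assms computable_comp[OF assms(1)] computable_comp[OF assms(2)])

text \<open>\<open>derives\<close> for the facts in a coded list. Bounding the witnesses
  \<open>z\<close> and \<open>v\<close> by \<open>c\<close> makes it decidable and loses nothing,
  because the output of a listed fact is below the code of the list
  (\<open>lmem_bound\<close>).\<close>

definition ljust :: "nat \<Rightarrow> nat \<Rightarrow> nat \<Rightarrow> nat \<Rightarrow> nat \<Rightarrow> nat \<Rightarrow> nat \<Rightarrow> bool" where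
  "ljust c p t l r x y \<longleftrightarrow>
     t = 0 \<and> y = 0 \<or>
     t = 1 \<and> y = Suc x \<or>
     t = 2 \<and> y = pfst x \<or>
     t = 3 \<and> y = psnd x \<or>
     t = 4 \<and> lmem (fact3 l x (pfst y)) c \<and> lmem (fact3 r x (psnd y)) c \<or>
     t = 5 \<and> (\<exists>z<c. lmem (fact3 r x z) c \<and> lmem (fact3 l z y) c) \<or>
     t = 6 \<and> psnd x = 0 \<and> lmem (fact3 l (pfst x) y) c \<or>
     t = 7 \<and> lmem (fact3 l (ppair x y) 0) c \<and> (\<forall>k<y. \<exists>z<c. lmem (fact3 l (ppair x k) (Suc z)) c) \<or>
     t = 6 \<and> 0 < psnd x \<and> (\<exists>v<c. lmem (fact3 p (ppair (pfst x) (psnd x - 1)) v) c \<and>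
        lmem (fact3 r (ppair (pfst x) (ppair (psnd x - 1) v)) y) c)"

definition ljustified :: "nat \<Rightarrow> nat \<Rightarrow> bool" where
  "ljustified c u \<longleftrightarrow> ljust c (pfst u) (pfst (pfst u))
     (pfst (psnd (pfst u))) (psnd (psnd (pfst u))) (pfst (psnd u)) (psnd (psnd u))"

lemma lmem_bound: "lmem (fact3 p x y) (list_encode us) \<Longrightarrow> y < list_encode us"
  using in_set_less_list_encode[of "fact3 p x y" us] le_fact3_3[of y p x]
  by (auto simp: lmem_list_encode)

lemma lmem_bound_Suc: "lmem (fact3 p x (Suc y)) (list_encode us) \<Longrightarrow> y < list_encode us"
  by (rule Suc_lessD, rule lmem_bound)

lemma ljust_list_encode:
  "ljust (list_encode us) p t l r x y \<longleftrightarrow> derives (\<lambda>p x y. fact3 p x y \<in> set us) p t l r x y"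
proof -
  let ?c = "list_encode us"
  have 1: "(\<exists>z<?c. fact3 q u z \<in> set us \<and> Q z) \<longleftrightarrow> (\<exists>z. fact3 q u z \<in> set us \<and> Q z)" for q u Q
    using lmem_bound[of q u _ us] by (auto simp: lmem_list_encode)
  have 2: "(\<exists>z<?c. fact3 q u (Suc z) \<in> set us) \<longleftrightarrow> (\<exists>z. fact3 q u (Suc z) \<in> set us)" for q u
    using lmem_bound_Suc[of q u _ us] by (auto simp: lmem_list_encode)
  show ?thesis
    unfolding ljust_def derives_def lmem_list_encode 1 2 ..
qed

lemma ljustified_list_encode: "ljustified (list_encode us) u \<longleftrightarrow> justified (set us) u"
  unfolding ljustified_def justified_def ljust_list_encode ..

lemma decidable_ljust:
  assumes "computable c" "computable p" "computable t" "computable l" "computable r" "computable x" "computable y"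
  shows "decidable (\<lambda>z. ljust (c z) (p z) (t z) (l z) (r z) (x z) (y z))"
  unfolding ljust_def
  by (intro computable_intros assms assms[THEN computable_comp])

lemma decidable_ljustified [computable_intros]:
  assumes "computable f" "computable g" shows "decidable (\<lambda>x. ljustified (f x) (g x))"
  unfolding ljustified_def by (intro decidable_ljust computable_intros assms)

definition lderivation :: "nat \<Rightarrow> bool" where
  "lderivation c \<longleftrightarrow> (\<forall>i<c. ldrop i c = 0 \<or> ljustified (ltl (ldrop i c)) (lhd (ldrop i c)))"

lemma lderivation_list_encode: "lderivation (list_encode us) \<longleftrightarrow> derivation us"
proof -
  have "lderivation (list_encode us) \<longleftrightarrow> (\<forall>i<length us. justified (set (drop (Suc i) us)) (us ! i))"
  proof -
    have "list_encode (drop i us) = 0 \<or> ljustified (ltl (list_encode (drop i us))) (lhd (list_encode (drop i us)))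
        \<longleftrightarrow> (i < length us \<longrightarrow> justified (set (drop (Suc i) us)) (us ! i))" for i
      by (cases "i < length us")
        (simp_all add: list_encode_eq_0 ltl_list_encode lhd_ldrop ljustified_list_encode drop_Suc tl_drop)
    then show ?thesis
      unfolding lderivation_def ldrop_list_encode
      using length_le_list_encode[of us] by (meson less_le_trans)
  qed
  also have "\<dots> \<longleftrightarrow> derivation us"
    by (induction us) (simp_all add: All_less_Suc2)
  finally show ?thesis .
qed

text \<open>The certificate \<open>s\<close> is a pair of the output and a derivation.\<close>

definition kleene_T :: "nat \<Rightarrow> nat \<Rightarrow> nat \<Rightarrow> bool" where
  "kleene_T p x s \<longleftrightarrow> lderivation (psnd s) \<and> lmem (fact3 p x (pfst s)) (psnd s)"

lemma decidable_kleene_T [computable_intros]: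
  assumes "computable f" "computable g" "computable h" shows "decidable (\<lambda>x. kleene_T (f x) (g x) (h x))"
proof -
  have "decidable lderivation" unfolding lderivation_def by (intro computable_intros)
  note L = decidable_comp[OF this]
  show ?thesis unfolding kleene_T_def by (intro computable_intros assms L)
qed

theorem Kleene_normal_form:
  assumes "partrec f"
  shows "\<exists>p. \<forall>x y. f x = Some y \<longleftrightarrow> (\<exists>s. kleene_T p x s \<and> pfst s = y)"
proof -
  have "evaluates p x y \<longleftrightarrow> (\<exists>s. kleene_T p x s \<and> pfst s = y)" for p x y
  proof
    assume "evaluates p x y"
    then obtain us where "derivation us" "fact3 p x y \<in> set us"
      by (auto simp: evaluates_def derivable_def)
    then show "\<exists>s. kleene_T p x s \<and> pfst s = y"
      by (intro exI[of _ "ppair y (list_encode us)"])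
        (simp add: kleene_T_def lderivation_list_encode lmem_list_encode)
  next
    assume "\<exists>s. kleene_T p x s \<and> pfst s = y"
    then obtain s where "kleene_T p x s" "pfst s = y" by blast
    then show "evaluates p x y"
      using lderivation_list_encode[of "list_decode (psnd s)"] lmem_list_encode[of _ "list_decode (psnd s)"]
      by (auto simp: kleene_T_def evaluates_def derivable_def)
  qed
  with evaluates_complete[OF assms] show ?thesis by simp
qed

corollary computable_index:
  assumes "computable f" shows "\<exists>p. (\<forall>x s. kleene_T p x s \<longrightarrow> pfst s = f x) \<and> (\<forall>x. \<exists>s. kleene_T p x s)"
  using Kleene_normal_form[OF assms[unfolded computable_def]] by (metis option.inject)

corollary ce_set_index:
  assumes "ce_set W" shows "\<exists>p. W = {x. \<exists>s. kleene_T p x s}"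
  using assms Kleene_normal_form unfolding ce_set_def by (fastforce simp: dom_def)

section \<open>A universal prefix-free machine\<close>

definition str_of :: "nat \<Rightarrow> string2" where "str_of = inv str_code"

lemma str_of_str_code [simp]: "str_of (str_code \<sigma>) = \<sigma>"
  unfolding str_of_def by (rule inv_f_f) (rule bij_is_inj[OF bij_str_code])

lemma str_code_str_of [simp]: "str_code (str_of n) = n"
  unfolding str_of_def by (rule surj_f_inv_f) (rule bij_is_surj[OF bij_str_code])

lemma str_code_eq_iff [simp]: "str_code \<sigma> = str_code \<tau> \<longleftrightarrow> \<sigma> = \<tau>"
  using bij_str_code by (auto dest: bij_is_inj injD)

lemma str_of_eq_iff [simp]: "str_of m = str_of n \<longleftrightarrow> m = n"
  by (metis str_code_str_of)

lemma str_code_append: "str_code (\<sigma> @ \<tau>) = str_code \<sigma> + 2 ^ length \<sigma> * str_code \<tau>"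
  by (induction \<sigma>) auto

text \<open>The strings of length \<open>n\<close> have the codes from \<open>2 ^ n - 1\<close> to
  \<open>2 ^ Suc n - 2\<close>, so the length can be read off the code.\<close>

lemma str_code_bounds: "2 ^ length \<sigma> \<le> Suc (str_code \<sigma>)" "Suc (str_code \<sigma>) < 2 ^ Suc (length \<sigma>)"
  by (induction \<sigma>) auto

lemma computable_length_str_of [computable_intros]:
  assumes "computable f" shows "computable (\<lambda>x. length (str_of (f x)))"
proof -
  have *: "length (str_of n) = (LEAST j. Suc n < 2 ^ Suc j)" for n
  proof (rule Least_equality[symmetric])
    show "Suc n < 2 ^ Suc (length (str_of n))"
      using str_code_bounds(2)[of "str_of n"] by simp
  next
    fix j assume "Suc n < 2 ^ Suc j"
    with str_code_bounds(1)[of "str_of n"] have "(2::nat) ^ length (str_of n) < 2 ^ Suc j"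
      by simp
    then have "length (str_of n) < Suc j"
      by (simp only: power_strict_increasing_iff[of "2::nat"] one_less_numeral_iff semiring_norm)
    then show "length (str_of n) \<le> j" by simp
  qed
  have "computable (\<lambda>n. length (str_of n))"
    unfolding *
  proof (rule computable_Least)
    show "decidable (\<lambda>z. Suc (pfst z) < 2 ^ Suc (psnd z))" by (intro computable_intros)
    show "\<exists>s. Suc n < 2 ^ Suc s" for n
      using str_code_bounds(2)[of "str_of n"] by auto
  qed
  then show ?thesis using assms by (rule computable_comp)
qed

text \<open>By \<open>str_code_append\<close> an extension of the string with code \<open>m\<close>
  has code \<open>m + 2 ^ length (str_of m) * r\<close>, where \<open>r\<close> codes the remainder
  and is bounded by the whole code.\<close>

lemma decidable_prefix [computable_intros]:
  assumes "computable f" "computable g" shows "decidable (\<lambda>x. prefix (str_of (f x)) (str_of (g x)))"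
proof -
  have *: "prefix (str_of m) (str_of n) \<longleftrightarrow> (\<exists>r<Suc n. n = m + 2 ^ length (str_of m) * r)" for m n
  proof
    assume "prefix (str_of m) (str_of n)"
    then obtain \<rho> where "str_of n = str_of m @ \<rho>" by (auto simp: prefix_def)
    then have n: "n = m + 2 ^ length (str_of m) * str_code \<rho>"
      by (metis str_code_append str_code_str_of)
    moreover have "str_code \<rho> \<le> 2 ^ length (str_of m) * str_code \<rho>" by simp
    then have "str_code \<rho> \<le> n" using n by linarith
    ultimately show "\<exists>r<Suc n. n = m + 2 ^ length (str_of m) * r"
      by (intro exI[of _ "str_code \<rho>"]) simp
  next
    assume "\<exists>r<Suc n. n = m + 2 ^ length (str_of m) * r"
    then obtain r where "n = str_code (str_of m @ str_of r)" by (auto simp: str_code_append)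
    then show "prefix (str_of m) (str_of n)" by (metis prefixI str_of_str_code)
  qed
  show ?thesis
    unfolding * by (intro computable_intros assms assms[THEN computable_comp])
qed

text \<open>
  With \<open>s = \<langle>input, certificate\<rangle>\<close>, a halting computation is accepted only if no earlier one has a
  comparable input. This makes the domain of every program prefix-free and does not change the
  programs for which it already is.
\<close>

definition stage :: "nat \<Rightarrow> nat \<Rightarrow> bool" where
  "stage e s \<longleftrightarrow> kleene_T e (pfst s) (psnd s) \<and>
     (\<forall>r<s. kleene_T e (pfst r) (psnd r) \<longrightarrow>
        \<not> (prefix (str_of (pfst r)) (str_of (pfst s)) \<or> prefix (str_of (pfst s)) (str_of (pfst r))))"

text \<open>If \<open>s\<close> and \<open>r\<close> differed, the smaller would bar the
  larger.\<close>

lemma stage_unique: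
  assumes "stage e s" "stage e r" "prefix (str_of (pfst s)) (str_of (pfst r))"
  shows "s = r"
  using assms unfolding stage_def by (metis linorder_neqE_nat)

lemma decidable_stage [computable_intros]:
  assumes "computable f" "computable g" shows "decidable (\<lambda>x. stage (f x) (g x))"
proof -
  have "decidable (\<lambda>x. stage (pfst x) (psnd x))" unfolding stage_def by (intro computable_intros)
  from decidable_comp[OF this computable_ppair[OF assms]] show ?thesis by simp
qed

text \<open>A self-delimiting unary code: it separates program from input and makes inputs for
  different programs incomparable.\<close>

definition machine_prefix :: "nat \<Rightarrow> string2" where
  "machine_prefix e = replicate e True @ [False]"

lemma prefix_machine_prefix:
  "prefix (machine_prefix d @ \<sigma>) (machine_prefix e @ \<tau>) \<longleftrightarrow> d = e \<and> prefix \<sigma> \<tau>"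
proof (induction d arbitrary: e)
  case 0
  show ?case by (cases e) (auto simp: machine_prefix_def)
next
  case (Suc d)
  then show ?case by (cases e) (auto simp: machine_prefix_def)
qed

lemma machine_prefix_append_eq:
  "machine_prefix d @ \<sigma> = machine_prefix e @ \<tau> \<longleftrightarrow> d = e \<and> \<sigma> = \<tau>"
  unfolding prefix_order.eq_iff[of "machine_prefix d @ \<sigma>"] prefix_order.eq_iff[of \<sigma>] prefix_machine_prefix
  by blast

lemma computable_machine_prefix [computable_intros]:
  assumes "computable f" "computable g"
  shows "computable (\<lambda>x. str_code (machine_prefix (f x) @ str_of (g x)))"
proof -
  have *: "str_code (machine_prefix e @ \<tau>) = rec_nat (2 * str_code \<tau> + 1) (\<lambda>_ r. 2 * r + 2) e" for e \<tau>
    by (induction e) (auto simp: machine_prefix_def)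
  show ?thesis unfolding * str_code_str_of by (intro computable_intros assms)
qed

text \<open>Here \<open>s = \<langle>program, \<langle>input, certificate\<rangle>\<rangle>\<close>.\<close>

definition halts_at :: "nat \<Rightarrow> nat \<Rightarrow> bool" where
  "halts_at c s \<longleftrightarrow> c = str_code (machine_prefix (pfst s) @ str_of (pfst (psnd s))) \<and> stage (pfst s) (psnd s)"

definition uni :: "string2 \<rightharpoonup> string2" where
  "uni \<sigma> = (if \<exists>s. halts_at (str_code \<sigma>) s
     then Some (str_of (pfst (psnd (psnd (LEAST s. halts_at (str_code \<sigma>) s))))) else None)"

lemma halts_at_str_code:
  "halts_at (str_code \<sigma>) s \<longleftrightarrow> \<sigma> = machine_prefix (pfst s) @ str_of (pfst (psnd s)) \<and> stage (pfst s) (psnd s)"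
  unfolding halts_at_def str_code_eq_iff ..

lemma halts_at_prefix_unique:
  assumes "halts_at (str_code \<sigma>) s" "halts_at (str_code \<tau>) r" "prefix \<sigma> \<tau>"
  shows "s = r"
proof -
  have "pfst s = pfst r" "prefix (str_of (pfst (psnd s))) (str_of (pfst (psnd r)))"
    using assms by (simp_all add: halts_at_str_code prefix_machine_prefix)
  moreover from this have "psnd s = psnd r"
    using assms by (intro stage_unique[of "pfst r"]) (simp_all add: halts_at_str_code)
  ultimately show ?thesis by (metis ppair_collapse)
qed

lemma uni_eqI:
  assumes "halts_at (str_code \<sigma>) s" shows "uni \<sigma> = Some (str_of (pfst (psnd (psnd s))))"
proof -
  have "(LEAST s. halts_at (str_code \<sigma>) s) = s"
    using assms by (intro Least_equality) (auto dest: halts_at_prefix_unique)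
  then show ?thesis using assms by (auto simp: uni_def)
qed

lemma prefix_free_uni: "prefix_free_machine uni"
  unfolding prefix_free_machine_def
proof (intro conjI exI[of _ "\<lambda>n. if \<exists>s. halts_at n s then Some (pfst (psnd (psnd (LEAST s. halts_at n s)))) else None"]
    allI ballI impI)
  show "partrec (\<lambda>n. if \<exists>s. halts_at n s then Some (pfst (psnd (psnd (LEAST s. halts_at n s)))) else None)"
    by (rule partrec_search[where g = "\<lambda>n s. pfst (psnd (psnd s))"])
      (intro computable_intros | unfold halts_at_def)+
next
  fix \<sigma> \<tau> assume "\<sigma> \<in> dom uni" "\<tau> \<in> dom uni" "prefix \<sigma> \<tau>"
  then obtain s r where "halts_at (str_code \<sigma>) s" "halts_at (str_code \<tau>) r"
    by (auto simp: uni_def split: if_splits)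
  with \<open>prefix \<sigma> \<tau>\<close> show "\<sigma> = \<tau>"
    using halts_at_prefix_unique[of \<sigma> s \<tau> r] by (auto simp: halts_at_str_code)
qed (simp add: uni_def)

text \<open>For an index \<open>p\<close> of \<open>M\<close> the required prefix is
  \<open>machine_prefix p\<close>: as \<open>M\<close> is prefix-free, the filter
  \<open>stage\<close> keeps a computation for every input in its domain.\<close>

lemma universal_uni: "universal_pf_machine uni"
  unfolding universal_pf_machine_def
proof (intro conjI prefix_free_uni allI impI)
  fix M assume M: "prefix_free_machine M"
  then obtain f where f: "partrec f" "\<And>\<sigma>. f (str_code \<sigma>) = map_option str_code (M \<sigma>)"
    and pf: "\<And>\<sigma> \<tau>. \<sigma> \<in> dom M \<Longrightarrow> \<tau> \<in> dom M \<Longrightarrow> prefix \<sigma> \<tau> \<Longrightarrow> \<sigma> = \<tau>"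
    unfolding prefix_free_machine_def by blast
  from Kleene_normal_form[OF f(1)] obtain p where
    p: "\<And>x y. f x = Some y \<longleftrightarrow> (\<exists>s. kleene_T p x s \<and> pfst s = y)" by blast
  have run: "M (str_of t) = Some (str_of (pfst w))" if "kleene_T p t w" for t w
  proof -
    have "f t = Some (pfst w)" using p that by blast
    with f(2)[of "str_of t"] show ?thesis by (cases "M (str_of t)") auto
  qed
  have "uni (machine_prefix p @ \<tau>) = M \<tau>" for \<tau>
  proof (cases "M \<tau>")
    case None
    have "\<not> halts_at (str_code (machine_prefix p @ \<tau>)) s" for s
    proof
      assume "halts_at (str_code (machine_prefix p @ \<tau>)) s"
      then have "p = pfst s" "\<tau> = str_of (pfst (psnd s))" "kleene_T p (pfst (psnd s)) (psnd (psnd s))"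
        by (auto simp: halts_at_str_code machine_prefix_append_eq stage_def)
      with run None show False by auto
    qed
    with None show ?thesis by (simp add: uni_def)
  next
    case (Some \<upsilon>)
    \<comment> \<open>The first halting computation whose input is comparable with
      \<open>\<tau>\<close>. Both strings lie in the domain of \<open>M\<close>, so they coincide,
      and minimality gives \<open>stage\<close>.\<close>
    let ?P = "\<lambda>s. kleene_T p (pfst s) (psnd s) \<and> (prefix (str_of (pfst s)) \<tau> \<or> prefix \<tau> (str_of (pfst s)))"
    have "f (str_code \<tau>) = Some (str_code \<upsilon>)" using f(2) Some by simp
    with p obtain w where "kleene_T p (str_code \<tau>) w" by blast
    then have "?P (ppair (str_code \<tau>) w)" by simp
    then have "?P (LEAST s. ?P s)" by (rule LeastI)
    moreover define s where "s = (LEAST s. ?P s)"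
    ultimately have P: "kleene_T p (pfst s) (psnd s)" "prefix (str_of (pfst s)) \<tau> \<or> prefix \<tau> (str_of (pfst s))"
      by simp_all
    have \<tau>: "str_of (pfst s) = \<tau>"
    proof -
      have "str_of (pfst s) \<in> dom M" using P(1) run by auto
      moreover have "\<tau> \<in> dom M" using Some by auto
      ultimately show ?thesis using P(2) pf by metis
    qed
    have "stage p s"
      unfolding stage_def \<tau>
    proof (intro conjI allI impI)
      show "kleene_T p (pfst s) (psnd s)" by (rule P)
      fix r assume "r < s" "kleene_T p (pfst r) (psnd r)"
      with not_less_Least[of r ?P]
      show "\<not> (prefix (str_of (pfst r)) \<tau> \<or> prefix \<tau> (str_of (pfst r)))" unfolding s_def by blast
    qed
    with \<tau> have "halts_at (str_code (machine_prefix p @ \<tau>)) (ppair p s)"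
      by (simp add: halts_at_str_code)
    from uni_eqI[OF this] run[of "pfst s" "psnd s"] \<open>stage p s\<close> \<tau> show ?thesis
      by (simp add: stage_def)
  qed
  then show "\<exists>\<rho>. \<forall>\<tau>. uni (\<rho> @ \<tau>) = M \<tau>" by blast
qed

section \<open>The fixed universal machine and its complexity \<open>K\<close>\<close>

lemma universal_univ_machine: "universal_pf_machine univ_machine"
  unfolding univ_machine_def by (rule someI[where P = universal_pf_machine, OF universal_uni])

lemma prefix_free_univ_machine: "prefix_free_machine univ_machine"
  using universal_univ_machine unfolding universal_pf_machine_def by blast

text \<open>The universal machine simulates the machine that sends only the empty string to
  \<sigma>, so the \<open>LEAST\<close> in \<open>K\<close> is taken over a nonempty set.\<close>

lemma K_attained: "\<exists>\<tau>. length \<tau> = K \<sigma> \<and> univ_machine \<tau> = Some \<sigma>"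
proof -
  define M :: "string2 \<rightharpoonup> string2" where "M = [[] \<mapsto> \<sigma>]"
  have "prefix_free_machine M"
    unfolding prefix_free_machine_def
  proof (intro conjI exI[of _ "\<lambda>n. if \<exists>s::nat. n = 0 then Some (str_code \<sigma>) else None"] allI ballI impI)
    show "partrec (\<lambda>n. if \<exists>s::nat. n = 0 then Some (str_code \<sigma>) else None)"
      by (rule partrec_search[where g = "\<lambda>n s. str_code \<sigma>"]) (intro computable_intros)+
    show "(if \<exists>s::nat. str_code \<tau> = 0 then Some (str_code \<sigma>) else None) = map_option str_code (M \<tau>)" for \<tau>
      by (cases \<tau>) (auto simp: M_def)
  qed (auto simp: M_def split: if_splits)
  with universal_univ_machine obtain \<rho> where "\<And>\<tau>. univ_machine (\<rho> @ \<tau>) = M \<tau>"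
    unfolding universal_pf_machine_def by blast
  then have "univ_machine (\<rho> @ []) = Some \<sigma>" by (simp only: M_def fun_upd_same)
  then have "\<exists>n \<tau>. length \<tau> = n \<and> univ_machine \<tau> = Some \<sigma>" by blast
  then show ?thesis unfolding K_def by (rule LeastI_ex)
qed

section \<open>The measure\<close>

text \<open>The string with code \<open>c\<close>, continued by zeros.\<close>

definition seq :: "nat \<Rightarrow> cantor" where
  "seq c i \<longleftrightarrow> (let d = rec_nat c (\<lambda>_ r. (r - 1) div 2) i in d \<noteq> 0 \<and> even d)"

text \<open>In bijective base 2 the map \<open>(r - 1) div 2\<close> drops the first digit, and the
  first bit is \<open>True\<close> exactly if the code is nonzero and even.\<close>

lemma seq_str_code: "seq (str_code \<sigma>) i \<longleftrightarrow> i < length \<sigma> \<and> \<sigma> ! i"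
proof -
  have 1: "(str_code \<tau> - 1) div 2 = str_code (tl \<tau>)" for \<tau>
    by (cases \<tau>) auto
  have 2: "rec_nat (str_code \<sigma>) (\<lambda>_ r. (r - 1) div 2) i = str_code (drop i \<sigma>)"
    by (induction i) (simp_all only: rec_nat_0_imp rec_nat_Suc_imp old.nat.simps drop_0 1 tl_drop drop_Suc)
  have 3: "str_code \<tau> \<noteq> 0 \<and> even (str_code \<tau>) \<longleftrightarrow> \<tau> \<noteq> [] \<and> hd \<tau>" for \<tau>
    by (cases \<tau>) auto
  show ?thesis
    unfolding seq_def 2 Let_def 3 by (cases "i < length \<sigma>") (simp_all add: hd_drop_conv_nth)
qed

lemma length_restr [simp]: "length (X \<restriction> n) = n"
  by (simp add: restr_def)

lemma nth_restr: "i < n \<Longrightarrow> (X \<restriction> n) ! i = X i"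
  by (simp add: restr_def)

lemma restr_eq_iff: "X \<restriction> n = Y \<restriction> n \<longleftrightarrow> (\<forall>i<n. X i = Y i)"
  by (auto simp: restr_def)

lemma restr_seq: "seq (str_code \<sigma>) \<restriction> length \<sigma> = \<sigma>"
  by (rule nth_equalityI) (auto simp: nth_restr seq_str_code)

lemma seq_restr: "i < n \<Longrightarrow> seq (str_code (X \<restriction> n)) i = X i"
  by (simp add: seq_str_code nth_restr)

lemma cyl_restr: "cyl (X \<restriction> n) = {Y. \<forall>i<n. Y i = X i}"
  by (simp add: cyl_def restr_eq_iff)

lemma decidable_even [computable_intros]: assumes "computable f" shows "decidable (\<lambda>x. even (f x))"
proof -
  have *: "even n \<longleftrightarrow> (\<exists>k<Suc n. n = 2 * k)" for n :: nat
    by (auto elim!: evenE)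
  show ?thesis unfolding * by (intro computable_intros assms assms[THEN computable_comp])
qed

lemma computable_div2 [computable_intros]: assumes "computable f" shows "computable (\<lambda>x. f x div 2)"
proof -
  have *: "n div 2 = (LEAST q. n < 2 * Suc q)" for n :: nat
    by (rule Least_equality[symmetric]; presburger)
  have "computable (\<lambda>n. n div 2)"
    unfolding *
  proof (rule computable_Least)
    show "decidable (\<lambda>z. pfst z < 2 * Suc (psnd z))" by (intro computable_intros)
    show "\<exists>q. n < 2 * Suc q" for n by (rule exI[of _ n]) simp
  qed
  then show ?thesis using assms by (rule computable_comp)
qed

lemma decidable_seq [computable_intros]: "computable f \<Longrightarrow> computable g \<Longrightarrow> decidable (\<lambda>x. seq (f x) (g x))"
  unfolding seq_def Let_def by (intro computable_intros)

text \<open>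
  \<open>level e i\<close> counts the splits below \<open>i\<close>. The first component of \<open>i\<close> is padding: it lets every
  certificate reappear at arbitrarily large positions.
\<close>

definition splits_if :: "nat \<Rightarrow> nat \<Rightarrow> nat \<Rightarrow> bool" where
  "splits_if e k i \<longleftrightarrow> kleene_T e k (psnd i) \<and> pfst (psnd i) + Suc e \<le> i"

definition level :: "nat \<Rightarrow> nat \<Rightarrow> nat" where
  "level e n = rec_nat 0 (\<lambda>i k. if splits_if e k i then Suc k else k) n"

definition splits :: "nat \<Rightarrow> nat \<Rightarrow> bool" where
  "splits e i \<longleftrightarrow> splits_if e (level e i) i"

lemma level_0 [simp]: "level e 0 = 0"
  by (simp add: level_def)

lemma level_Suc: "level e (Suc i) = (if splits e i then Suc (level e i) else level e i)"
  by (simp add: level_def splits_def)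

lemma mono_level: "mono (level e)"
  by (rule incseq_SucI) (simp add: level_Suc)

lemma level_eq_card: "level e n = card {i. i < n \<and> splits e i}"
proof (induction n)
  case (Suc n)
  have "{i. i < Suc n \<and> splits e i} = {i. i < n \<and> splits e i} \<union> (if splits e n then {n} else {})"
    by (auto simp: less_Suc_eq)
  then show ?case using Suc by (auto simp: level_Suc)
qed auto

lemma splits_gt: "splits e i \<Longrightarrow> e < i"
  by (simp add: splits_def splits_if_def)

lemma decidable_splits_if [computable_intros]:
  "computable f \<Longrightarrow> computable g \<Longrightarrow> computable h \<Longrightarrow> decidable (\<lambda>x. splits_if (f x) (g x) (h x))"
  unfolding splits_if_def by (intro computable_intros)

lemma computable_level [computable_intros]:
  assumes "computable f" "computable g" shows "computable (\<lambda>x. level (f x) (g x))"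
  unfolding level_def by (intro computable_intros assms assms[THEN computable_comp])

lemma decidable_splits [computable_intros]:
  "computable f \<Longrightarrow> computable g \<Longrightarrow> decidable (\<lambda>x. splits (f x) (g x))"
  unfolding splits_def by (intro computable_intros)

section \<open>Free positions and thinned sequences\<close>

definition lead :: "cantor \<Rightarrow> nat \<Rightarrow> bool" where
  "lead X e \<longleftrightarrow> X e \<and> (\<forall>i<e. \<not> X i)"

text \<open>The positions where a coin is tossed: all of them up to the first 1 of \<open>X\<close>,
  afterwards only the splits of its cone. Freeness at \<open>i\<close> depends only on the bits
  before \<open>i\<close>.\<close>

definition free :: "cantor \<Rightarrow> nat \<Rightarrow> bool" where
  "free X i \<longleftrightarrow> (\<forall>e<i. lead X e \<longrightarrow> splits e i)"

text \<open>Thinning never leaves a 1 at a position that is not free, so live initial segments are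
  those of positive measure.\<close>

definition live :: "cantor \<Rightarrow> nat \<Rightarrow> bool" where
  "live X n \<longleftrightarrow> (\<forall>i<n. X i \<longrightarrow> free X i)"

definition nfree :: "cantor \<Rightarrow> nat \<Rightarrow> nat" where
  "nfree X n = card {i. i < n \<and> free X i}"

text \<open>The measure is the image of the uniform measure under \<open>thin\<close>.\<close>

definition thin :: "cantor \<Rightarrow> cantor" where
  "thin X i \<longleftrightarrow> X i \<and> free X i"

lemma lead_unique: "lead X d \<Longrightarrow> lead X e \<Longrightarrow> d = e"
  unfolding lead_def by (rule linorder_cases[of d e]) auto

lemma lead_cong: "(\<And>i. i \<le> e \<Longrightarrow> X i = Y i) \<Longrightarrow> lead X e = lead Y e"
  by (auto simp: lead_def)

lemma free_cong: assumes "\<And>j. j < i \<Longrightarrow> X j = Y j" shows "free X i = free Y i"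
proof -
  have "lead X e = lead Y e" if "e < i" for e
    using assms that by (intro lead_cong) auto
  then show ?thesis by (auto simp: free_def)
qed

lemma live_nfree_cong:
  assumes "\<And>j. j < n \<Longrightarrow> X j = Y j" shows "live X n = live Y n" "nfree X n = nfree Y n"
proof -
  have *: "free X i = free Y i" if "i < n" for i
    using assms that by (intro free_cong) auto
  show "live X n = live Y n" using assms * by (auto simp: live_def)
  show "nfree X n = nfree Y n" 
    unfolding nfree_def using * by (intro arg_cong[where f = card]) auto
qed

lemma decidable_free [computable_intros]:
  assumes "computable f" "computable g" shows "decidable (\<lambda>x. free (seq (f x)) (g x))"
  unfolding free_def lead_def by (intro computable_intros assms assms[THEN computable_comp])

lemma decidable_live [computable_intros]:
  assumes "computable f" "computable g" shows "decidable (\<lambda>x. live (seq (f x)) (g x))"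
  unfolding live_def by (intro computable_intros assms assms[THEN computable_comp])

lemma nfree_Suc: "nfree X (Suc n) = (if free X n then Suc (nfree X n) else nfree X n)"
proof -
  have "{i. i < Suc n \<and> free X i} = {i. i < n \<and> free X i} \<union> (if free X n then {n} else {})"
    by (auto simp: less_Suc_eq)
  then show ?thesis by (auto simp: nfree_def)
qed

lemma computable_nfree [computable_intros]:
  assumes "computable f" "computable g" shows "computable (\<lambda>x. nfree (seq (f x)) (g x))"
proof -
  have *: "nfree X n = rec_nat 0 (\<lambda>i k. if free X i then Suc k else k) n" for X n
  proof (induction n)
    case 0
    show ?case by (simp add: nfree_def)
  qed (simp add: nfree_Suc)
  show ?thesis unfolding * by (intro computable_intros assms assms[THEN computable_comp])
qed

text \<open>Positions up to the first 1 are free and hence unchanged. Conversely a 1 of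
  \<open>thin Y\<close> is a 1 of \<open>Y\<close>, so \<open>Y\<close> has a first 1, and the two
  leads agree by uniqueness.\<close>

lemma thin_lead: "lead (thin Y) e \<longleftrightarrow> lead Y e"
proof -
  have *: "lead (thin Y) d" if "lead Y d" for d
    using that by (auto simp: lead_def thin_def free_def dest: less_trans)
  show ?thesis
  proof
    assume L: "lead (thin Y) e"
    then have "Y e" by (auto simp: lead_def thin_def)
    define d where "d = (LEAST d. Y d)"
    have "lead Y d" using \<open>Y e\<close> unfolding lead_def d_def by (metis LeastI not_less_Least)
    with *[OF this] L have "d = e" by (intro lead_unique)
    with \<open>lead Y d\<close> show "lead Y e" by simp
  qed (rule *)
qed

lemma thin_free: "free (thin Y) i \<longleftrightarrow> free Y i"
  by (simp add: free_def thin_lead)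

text \<open>Freeness depends on earlier bits only, so by induction \<open>X\<close> and
  \<open>Y\<close> have the same free positions while \<open>thin Y\<close> agrees with
  \<open>X\<close>. Hence the preimage of a cylinder under \<open>thin\<close> is empty or
  prescribes \<open>Y\<close> exactly at the free positions.\<close>

lemma thin_agrees_iff:
  "(\<forall>i<n. thin Y i = X i) \<longleftrightarrow> live X n \<and> (\<forall>i<n. free X i \<longrightarrow> Y i = X i)"
proof
  assume A: "\<forall>i<n. thin Y i = X i"
  have "free X i = free Y i" if "i < n" for i
    using free_cong[of i "thin Y" X] A that by (simp add: thin_free)
  with A show "live X n \<and> (\<forall>i<n. free X i \<longrightarrow> Y i = X i)"
    by (auto simp: live_def thin_def)
next
  assume A: "live X n \<and> (\<forall>i<n. free X i \<longrightarrow> Y i = X i)"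
  have "i < n \<Longrightarrow> thin Y i = X i" for i
  proof (induction i rule: less_induct)
    case (less i)
    then have "free X i = free Y i"
      using free_cong[of i "thin Y" X] by (simp add: thin_free)
    with A less.prems show ?case by (auto simp: live_def thin_def)
  qed
  then show "\<forall>i<n. thin Y i = X i" by blast
qed

section \<open>The coin measure and its image under thinning\<close>

instance bool :: second_countable_topology
proof
  show "\<exists>B :: bool set set. countable B \<and> open = generate_topology B"
    by (intro exI[of _ UNIV] conjI)
      (auto simp: fun_eq_iff Topological_Spaces.open_discrete intro: generate_topology.Basis countable_finite)
qed

definition coin :: "cantor measure" where
  "coin = Pi\<^sub>M UNIV (\<lambda>_. measure_pmf (pmf_of_set UNIV))"

interpretation flips: product_prob_space "\<lambda>_. measure_pmf (pmf_of_set (UNIV :: bool set))" "UNIV :: nat set"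
  by unfold_locales

interpretation coin: prob_space coin
  unfolding coin_def by (rule prob_space_PiM) (rule measure_pmf.prob_space_axioms)

lemma space_coin [simp]: "space coin = UNIV"
  by (simp add: coin_def space_PiM)

text \<open>This rests on the second countability of \<open>bool\<close>: the product sigma-algebra
  of countably many such spaces is the Borel one.\<close>

lemma sets_coin: "sets coin = sets borel"
proof -
  have "sets coin = sets (Pi\<^sub>M UNIV (\<lambda>_. borel :: bool measure))"
    unfolding coin_def by (intro sets_PiM_cong) (auto simp: sets_borel_eq_count_space)
  then show ?thesis by (simp add: sets_PiM_equal_borel)
qed

lemma emeasure_coin:
  assumes "finite J" shows "emeasure coin {Y. \<forall>i\<in>J. Y i = X i} = ennreal ((1 / 2) ^ card J)"
proof -
  have "emeasure coin {Y. \<forall>i\<in>J. Y i = X i} = (\<Prod>i\<in>J. emeasure (measure_pmf (pmf_of_set UNIV)) {X i})"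
    using flips.emeasure_PiM_Collect[OF _ assms, of "\<lambda>i. {X i}"] by (simp add: coin_def space_PiM)
  also have "\<dots> = (\<Prod>i\<in>J. ennreal (1 / 2))"
    by (simp add: emeasure_pmf_single)
  also have "\<dots> = ennreal ((1 / 2) ^ card J)"
    unfolding prod_constant by (rule ennreal_power) simp
  finally show ?thesis .
qed

lemma emeasure_coin_cyl: "emeasure coin (cyl \<sigma>) = ennreal ((1 / 2) ^ length \<sigma>)"
proof -
  have "cyl \<sigma> = {Y. \<forall>i\<in>{..<length \<sigma>}. Y i = seq (str_code \<sigma>) i}"
    using cyl_restr[of "seq (str_code \<sigma>)" "length \<sigma>"] by (simp add: restr_seq Ball_def)
  with emeasure_coin[of "{..<length \<sigma>}"] show ?thesis by simp
qed

lemma measurable_thin: "thin \<in> measurable coin borel"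
proof -
  have [measurable]: "(\<lambda>Y. Y i) \<in> measurable coin (count_space UNIV)" for i
  proof -
    have "(\<lambda>Y. Y i) \<in> measurable coin (measure_pmf (pmf_of_set (UNIV :: bool set)))"
      unfolding coin_def by (rule measurable_component_singleton) simp
    then show ?thesis by (simp cong: measurable_cong_sets)
  qed
  have "(\<lambda>Y i. Y i \<and> (\<forall>e<i. Y e \<and> (\<forall>j<e. \<not> Y j) \<longrightarrow> splits e i))
      \<in> measurable coin (Pi\<^sub>M UNIV (\<lambda>_. borel :: bool measure))"
  proof (rule measurable_PiM_single')
    fix i :: nat
    have "(\<lambda>Y. Y i \<and> (\<forall>e<i. Y e \<and> (\<forall>j<e. \<not> Y j) \<longrightarrow> splits e i)) \<in> measurable coin (count_space UNIV)"
      by measurable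
    then show "(\<lambda>Y. Y i \<and> (\<forall>e<i. Y e \<and> (\<forall>j<e. \<not> Y j) \<longrightarrow> splits e i)) \<in> measurable coin borel"
      by (simp add: sets_borel_eq_count_space cong: measurable_cong_sets)
  qed auto
  moreover have "thin = (\<lambda>Y i. Y i \<and> (\<forall>e<i. Y e \<and> (\<forall>j<e. \<not> Y j) \<longrightarrow> splits e i))"
    by (simp add: fun_eq_iff thin_def free_def lead_def)
  ultimately show ?thesis
    by (simp add: sets_PiM_equal_borel cong: measurable_cong_sets)
qed

definition thin_measure :: "cantor measure" where
  "thin_measure = distr coin borel thin"

lemma borel_prob_thin_measure: "borel_prob thin_measure"
  unfolding borel_prob_def thin_measure_def
  using coin.prob_space_distr[OF measurable_thin] by simp

interpretation thin: prob_space thin_measure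
  using borel_prob_thin_measure by (simp add: borel_prob_def)

lemma sets_thin_measure [simp]: "sets thin_measure = sets borel"
  and space_thin_measure [simp]: "space thin_measure = UNIV"
  by (simp_all add: thin_measure_def)

lemma measure_thin_cyl:
  "measure thin_measure (cyl (X \<restriction> n)) = (if live X n then (1 / 2) ^ nfree X n else 0)"
proof -
  let ?J = "{i. i < n \<and> free X i}"
  have "emeasure thin_measure (cyl (X \<restriction> n)) = emeasure coin (thin -` cyl (X \<restriction> n))"
    unfolding thin_measure_def
    by (subst emeasure_distr) (auto intro: measurable_thin borel_open open_cyl)
  also have "thin -` cyl (X \<restriction> n) = (if live X n then {Y. \<forall>i\<in>?J. Y i = X i} else {})"
    unfolding cyl_restr vimage_def using thin_agrees_iff[of n _ X] by auto
  also have "emeasure coin \<dots> = ennreal (if live X n then (1 / 2) ^ nfree X n else 0)"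
    using emeasure_coin[of ?J X] by (auto simp: nfree_def)
  finally show ?thesis by (simp add: measure_def)
qed

lemma measure_thin_cyl_le: "measure thin_measure (cyl (X \<restriction> n)) \<le> (1 / 2) ^ nfree X n"
  unfolding measure_thin_cyl by simp

lemma computable_thin_measure: "computable_measure thin_measure"
proof -
  \<comment> \<open>The values are 0 or powers of \<open>1 / 2\<close>, so one exact code serves
    every precision. Since \<open>real_of_code\<close> divides by a successor, the second component
    is a power of 2 minus 1.\<close>
  define q where "q x = (let c = pfst x; n = length (str_of c) in
    if live (seq c) n then ppair (int_encode 1) (2 ^ nfree (seq c) n - 1) else ppair (int_encode 0) 0)" for x
  have "computable q"
    unfolding q_def Let_def by (intro computable_intros)
  moreover have "real_of_code (q (ppair (str_code \<sigma>) n)) = measure thin_measure (cyl \<sigma>)" for \<sigma> n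
    using measure_thin_cyl[of "seq (str_code \<sigma>)" "length \<sigma>"]
    by (simp add: restr_seq q_def real_of_code_def Let_def power_one_over of_nat_diff)
  ultimately show ?thesis
    unfolding computable_measure_def computable_real_fun_def by (intro exI[of _ q]) simp
qed

lemma free_lead: assumes "lead X e" shows "free X i \<longleftrightarrow> i \<le> e \<or> splits e i"
proof -
  have "lead X d \<longleftrightarrow> d = e" for d using lead_unique[OF assms, of d] assms by blast
  then show ?thesis by (auto simp: free_def not_le)
qed

lemma nfree_lead:
  assumes "lead X e" "e < n" shows "nfree X n = Suc e + level e n"
proof -
  have "{i. i < n \<and> free X i} = {..e} \<union> {i. i < n \<and> splits e i}"
    using assms(2) by (auto simp: free_lead[OF assms(1)])
  moreover have "{..e} \<inter> {i. i < n \<and> splits e i} = {}"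
    using splits_gt[of e] by force
  ultimately show ?thesis
    by (simp add: nfree_def level_eq_card card_Un_disjoint)
qed

section \<open>Randomness\<close>

lemma restr_in_cyl: "X \<in> cyl (X \<restriction> n)"
  by (simp add: cyl_def)

lemma cyl_prefix: "prefix \<sigma> \<tau> \<Longrightarrow> cyl \<tau> \<subseteq> cyl \<sigma>"
proof -
  assume "prefix \<sigma> \<tau>"
  then obtain \<rho> where \<rho>: "\<tau> = \<sigma> @ \<rho>" by (auto simp: prefix_def)
  show ?thesis
  proof
    fix X assume "X \<in> cyl \<tau>"
    then have "take (length \<sigma>) (X \<restriction> length \<tau>) = \<sigma>" by (simp add: cyl_def \<rho>)
    then show "X \<in> cyl \<sigma>" by (simp add: cyl_def restr_def take_map \<rho>)
  qed
qed

lemma prefix_restr: "m \<le> n \<Longrightarrow> prefix (X \<restriction> m) (X \<restriction> n)"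
  unfolding restr_def using upt_add_eq_append[of 0 m "n - m"] by (auto simp: prefix_def)

lemma cyl_disjoint:
  assumes "\<not> prefix \<sigma> \<tau>" "\<not> prefix \<tau> \<sigma>" shows "cyl \<sigma> \<inter> cyl \<tau> = {}"
proof -
  have False if "X \<restriction> length \<sigma> = \<sigma>" "X \<restriction> length \<tau> = \<tau>" for X
    using prefix_restr[of "length \<sigma>" "length \<tau>" X] prefix_restr[of "length \<tau>" "length \<sigma>" X]
      assms nat_le_linear[of "length \<sigma>" "length \<tau>"] by (auto simp: that)
  then show ?thesis by (auto simp: cyl_def)
qed

lemma cyl_borel [simp]: "cyl \<sigma> \<in> sets borel"
  by (simp add: borel_open open_cyl)

lemma UN_cyl_borel [simp]: "(\<Union>\<sigma>\<in>A. cyl \<sigma>) \<in> sets borel"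
  by (simp add: borel_open open_cyl open_UN)

section \<open>Randomness for an arbitrary Borel probability measure\<close>

locale cantor_prob = prob_space M for M :: "cantor measure" +
  assumes sets_eq [measurable_cong, simp]: "sets M = sets borel"
begin

lemma space_eq [simp]: "space M = UNIV"
  using sets_eq_imp_space_eq[OF sets_eq] by simp

lemma singleton_eq_INT: "{X} = (\<Inter>n. cyl (X \<restriction> n))"
  by (auto simp: cyl_restr)

lemma singleton_sets [simp]: "{X} \<in> sets M"
  unfolding singleton_eq_INT by (intro sets.countable_INT) auto

lemma measure_singleton_le: "measure M {X} \<le> measure M (cyl (X \<restriction> n))"
  by (intro finite_measure_mono) (auto simp: restr_in_cyl)

lemma le_measure_singleton:
  assumes "\<And>n. m \<le> n \<Longrightarrow> \<epsilon> \<le> measure M (cyl (X \<restriction> n))" shows "\<epsilon> \<le> measure M {X}"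
proof -
  have "decseq (\<lambda>n. cyl (X \<restriction> n))"
    by (auto simp: decseq_def cyl_restr)
  then have "(\<lambda>n. measure M (cyl (X \<restriction> n))) \<longlonglongrightarrow> measure M (\<Inter>n. cyl (X \<restriction> n))"
    by (intro finite_Lim_measure_decseq) auto
  then show ?thesis
    unfolding singleton_eq_INT[symmetric] by (rule LIMSEQ_le_const) (use assms in blast)
qed

text \<open>The tests below are given by c.e. sets of pairs; escaping one is restated through
  initial segments, as \<open>X\<close> lies in all its own cylinders.\<close>

lemma MLR_escape:
  assumes "X \<in> MLR M" "ce_set W"
    and "\<And>i. measure M (\<Union>\<sigma>\<in>{\<sigma>. ppair i (str_code \<sigma>) \<in> W}. cyl \<sigma>) \<le> (1 / 2) ^ i"
  shows "\<exists>i. \<forall>n. ppair i (str_code (X \<restriction> n)) \<notin> W"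
proof -
  define U where "U i = (\<Union>\<sigma>\<in>{\<sigma>. ppair i (str_code \<sigma>) \<in> W}. cyl \<sigma>)" for i
  have "martin_loef_test M U"
    unfolding martin_loef_test_def uniformly_Sigma01_def
    by (intro conjI exI[of _ W] allI) (simp_all add: U_def assms(2,3))
  with assms(1) have "X \<notin> (\<Inter>i. U i)" unfolding MLR_def by blast
  then obtain i where "X \<notin> U i" by blast
  then have "\<forall>n. ppair i (str_code (X \<restriction> n)) \<notin> W"
    unfolding U_def using restr_in_cyl by blast
  then show ?thesis ..
qed

text \<open>Every test comes from a program, so countably many null sets cover the sequences that
  are not random. The null superset \<open>N\<close> avoids the measurability of
  \<open>MLR M\<close>.\<close>

lemma MLR_conull: "\<exists>N\<in>null_sets M. - MLR M \<subseteq> N"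
proof -
  define U where "U p i = (\<Union>\<sigma>\<in>{\<sigma>. \<exists>s. kleene_T p (ppair i (str_code \<sigma>)) s}. cyl \<sigma>)" for p i
  \<comment> \<open>Programs that do not give a test contribute the empty set.\<close>
  define N where "N p = (if martin_loef_test M (U p) then \<Inter>i. U p i else {})" for p
  have [simp]: "U p i \<in> sets borel" for p i unfolding U_def by (rule UN_cyl_borel)
  have "N p \<in> null_sets M" for p
  proof (cases "martin_loef_test M (U p)")
    case True
    have I: "(\<Inter>i. U p i) \<in> sets M" by (intro sets.countable_INT) auto
    have "measure M (\<Inter>i. U p i) \<le> (1 / 2) ^ i" for i
    proof -
      have "measure M (\<Inter>i. U p i) \<le> measure M (U p i)"
        by (intro finite_measure_mono) auto
      also have "\<dots> \<le> (1 / 2) ^ i" using True by (simp add: martin_loef_test_def)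
      finally show ?thesis .
    qed
    moreover have "(\<lambda>i. (1 / 2 :: real) ^ i) \<longlonglongrightarrow> 0"
      by (rule LIMSEQ_realpow_zero) auto
    ultimately have "measure M (\<Inter>i. U p i) \<le> 0"
      by (intro LIMSEQ_le_const[of "\<lambda>i. (1 / 2 :: real) ^ i"]) blast+
    then have "measure M (\<Inter>i. U p i) = 0" by (intro antisym) auto
    with True I show ?thesis by (simp add: N_def null_sets_def emeasure_eq_measure)
  qed (simp add: N_def)
  then have "(\<Union>p. N p) \<in> null_sets M" by (rule null_sets_UN)
  moreover have "X \<in> (\<Union>p. N p)" if "X \<notin> MLR M" for X
  proof -
    from that obtain V where V: "martin_loef_test M V" "X \<in> (\<Inter>i. V i)" by (auto simp: MLR_def)
    then obtain W where W: "ce_set W" "\<And>i. V i = (\<Union>\<sigma>\<in>{\<sigma>. ppair i (str_code \<sigma>) \<in> W}. cyl \<sigma>)"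
      unfolding martin_loef_test_def uniformly_Sigma01_def by blast
    obtain p where "W = {x. \<exists>s. kleene_T p x s}" using ce_set_index[OF W(1)] by blast
    with W(2) have "V = U p" by (simp add: U_def fun_eq_iff)
    with V show ?thesis by (auto simp: N_def)
  qed
  ultimately show ?thesis by blast
qed

lemma continuous_uniform:
  assumes "continuous_measure M" "0 < \<epsilon>"
  shows "\<exists>n. \<forall>\<sigma>. length \<sigma> = n \<longrightarrow> measure M (cyl \<sigma>) < \<epsilon>"
proof (rule ccontr)
  assume "\<not> ?thesis"
  then have H: "\<exists>\<sigma>. length \<sigma> = n \<and> \<epsilon> \<le> measure M (cyl \<sigma>)" for n
    by (meson not_less)
  \<comment> \<open>Koenig's lemma: a path through the big strings would be an atom.\<close>
  define big where "big \<sigma> \<longleftrightarrow> (\<forall>m. \<exists>\<tau>. length \<tau> = m \<and> \<epsilon> \<le> measure M (cyl (\<sigma> @ \<tau>)))" for \<sigma>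
  have "\<exists>b. big (\<sigma> @ [b])" if "big \<sigma>" for \<sigma>
  proof (rule ccontr)
    assume "\<nexists>b. big (\<sigma> @ [b])"
    then obtain m where m: "\<And>b \<tau>. length \<tau> = m b \<Longrightarrow> \<not> \<epsilon> \<le> measure M (cyl ((\<sigma> @ [b]) @ \<tau>))"
      unfolding big_def by metis
    from \<open>big \<sigma>\<close> obtain \<tau> where \<tau>: "length \<tau> = Suc (m True + m False)" "\<epsilon> \<le> measure M (cyl (\<sigma> @ \<tau>))"
      unfolding big_def by blast
    then obtain b \<upsilon> where \<upsilon>: "\<tau> = b # \<upsilon>" by (cases \<tau>) auto
    \<comment> \<open>The length \<open>Suc (m True + m False)\<close> leaves at least
      \<open>m b\<close> bits after the first, whichever \<open>b\<close> that is.\<close>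
    have le: "m b \<le> length \<upsilon>" using \<tau>(1) \<upsilon> by (cases b) auto
    have "prefix ((\<sigma> @ [b]) @ take (m b) \<upsilon>) (\<sigma> @ \<tau>)"
      using take_is_prefix[of "m b" \<upsilon>] by (simp add: \<upsilon>)
    then have "measure M (cyl (\<sigma> @ \<tau>)) \<le> measure M (cyl ((\<sigma> @ [b]) @ take (m b) \<upsilon>))"
      by (intro finite_measure_mono cyl_prefix) auto
    with \<tau>(2) m[of "take (m b) \<upsilon>" b] le show False by simp
  qed
  then have step: "big (\<sigma> @ [SOME b. big (\<sigma> @ [b])])" if "big \<sigma>" for \<sigma>
    using that by (meson someI_ex)
  define s where "s = rec_nat [] (\<lambda>_ \<sigma>. \<sigma> @ [SOME b. big (\<sigma> @ [b])])"
  define X where "X i = (SOME b. big (s i @ [b]))" for i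
  have s: "s n = X \<restriction> n" for n
    by (induction n) (simp_all add: s_def X_def restr_def)
  have "big (s n)" for n
  proof (induction n)
    case 0
    show ?case using H by (simp add: s_def big_def)
  next
    case (Suc n)
    then show ?case using step[of "s n"] by (simp add: s_def)
  qed
  then have "\<epsilon> \<le> measure M (cyl (X \<restriction> n))" for n
    unfolding big_def s by (metis append_Nil2 length_0_conv)
  then have "\<epsilon> \<le> measure M {X}" by (rule le_measure_singleton)
  with assms(2) have "0 < measure M {X}" by linarith
  with assms(1) show False
    by (auto simp: continuous_measure_def atomic_measure_def Atoms_def)
qed

end

lemma cantor_prob_iff: "cantor_prob M \<longleftrightarrow> borel_prob M"
  by (simp add: cantor_prob_def cantor_prob_axioms_def borel_prob_def)

interpretation thin: cantor_prob thin_measure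
  by (simp add: cantor_prob_iff borel_prob_thin_measure)

interpretation coin: cantor_prob coin
  by (simp add: cantor_prob_def cantor_prob_axioms_def sets_coin coin.prob_space_axioms)

text \<open>\<open>r\<close> codes a rational number that is negative if \<^term>\<open>pfst r\<close> is odd.\<close>

definition real_code_less :: "nat \<Rightarrow> nat \<Rightarrow> bool" where
  "real_code_less r m \<longleftrightarrow> \<not> even (pfst r) \<or> pfst r div 2 * 2 ^ m < Suc (psnd r)"

lemma real_code_less_iff: "real_code_less r m \<longleftrightarrow> real_of_code r < (1 / 2) ^ m"
proof (cases "even (pfst r)")
  case True
  then have "real_of_code r = real (pfst r div 2) / real (Suc (psnd r))"
    by (simp add: real_of_code_def pfst_def psnd_def case_prod_beta int_decode_def sum_decode_def)
  moreover have "a / b < (1 / 2) ^ m \<longleftrightarrow> a * 2 ^ m < b" if "0 < b" for a b :: real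
    using that by (simp add: power_one_over field_simps)
  ultimately have "real_of_code r < (1 / 2) ^ m \<longleftrightarrow> real (pfst r div 2) * 2 ^ m < real (Suc (psnd r))"
    by simp
  also have "\<dots> \<longleftrightarrow> real (pfst r div 2 * 2 ^ m) < real (Suc (psnd r))"
    by simp
  finally show ?thesis using True by (simp only: of_nat_less_iff real_code_less_def) simp
next
  case False
  then have "real_of_code r < 0"
    by (simp add: real_of_code_def pfst_def psnd_def case_prod_beta int_decode_def sum_decode_def divide_neg_pos)
  also have "0 < (1 / 2 :: real) ^ m" by simp
  finally show ?thesis using False by (simp add: real_code_less_def)
qed

lemma decidable_real_code_less [computable_intros]:
  assumes "computable f" "computable g" shows "decidable (\<lambda>x. real_code_less (f x) (g x))"
  unfolding real_code_less_def by (intro computable_intros assms)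

text \<open>Approximations with error at most a quarter of \<open>(1 / 2) ^ (2 * k)\<close> are
  compared with half of it. The search for \<open>small\<close> succeeds once all measures are below
  a quarter, which \<open>continuous_uniform\<close> provides, and success bounds them by three
  quarters.\<close>

lemma computable_modulus:
  assumes "borel_prob \<nu>" "computable_measure \<nu>" "continuous_measure \<nu>"
  shows "\<exists>g. computable g \<and> (\<forall>k \<sigma>. length \<sigma> = g k \<longrightarrow> measure \<nu> (cyl \<sigma>) \<le> (1 / 2) ^ (2 * k))"
proof -
  interpret cantor_prob \<nu> using assms(1) by (simp add: cantor_prob_iff)
  obtain q where q: "computable q"
    "\<And>\<sigma> n. \<bar>real_of_code (q (ppair (str_code \<sigma>) n)) - measure \<nu> (cyl \<sigma>)\<bar> \<le> (1 / 2) ^ n"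
    using assms(2) unfolding computable_measure_def computable_real_fun_def by blast
  \<comment> \<open>The codes of strings of length \<open>j\<close> are all below
    \<open>2 ^ Suc j\<close>, which makes the quantifier over strings bounded.\<close>
  define small where "small k j \<longleftrightarrow> (\<forall>c<2 ^ Suc j. length (str_of c) = j \<longrightarrow>
    real_code_less (q (ppair c (2 * k + 2))) (2 * k + 1))" for k j
  have small_iff: "small k j \<longleftrightarrow> (\<forall>\<sigma>. length \<sigma> = j \<longrightarrow>
      real_of_code (q (ppair (str_code \<sigma>) (2 * k + 2))) < (1 / 2) ^ (2 * k + 1))" for k j
    unfolding small_def real_code_less_iff
    by (metis Suc_lessD str_code_bounds(2) str_code_str_of str_of_str_code)
  have decidable: "decidable (\<lambda>z. small (pfst z) (psnd z))"
    unfolding small_def by (intro computable_intros computable_comp[OF q(1)])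
  have pow: "(1 / 2 :: real) ^ (2 * k + 2) = (1 / 2) ^ (2 * k) / 4"
    "(1 / 2 :: real) ^ (2 * k + 1) = (1 / 2) ^ (2 * k) / 2" for k
    by (simp_all add: power_add power2_eq_square)
  have ex: "\<exists>j. small k j" for k
  proof -
    obtain j where j: "\<And>\<sigma>. length \<sigma> = j \<Longrightarrow> measure \<nu> (cyl \<sigma>) < (1 / 2) ^ (2 * k + 2)"
      using continuous_uniform[OF assms(3), of "(1 / 2) ^ (2 * k + 2)"] by auto
    have "real_of_code (q (ppair (str_code \<sigma>) (2 * k + 2))) < (1 / 2) ^ (2 * k + 1)" if "length \<sigma> = j" for \<sigma>
      using j[OF that] q(2)[of \<sigma> "2 * k + 2"] unfolding pow abs_le_iff by linarith
    then show ?thesis unfolding small_iff by blast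
  qed
  define g where "g k = (LEAST j. small k j)" for k
  have "computable g" unfolding g_def using decidable ex by (rule computable_Least)
  moreover have "measure \<nu> (cyl \<sigma>) \<le> (1 / 2) ^ (2 * k)" if "length \<sigma> = g k" for k \<sigma>
  proof -
    have "small k (g k)" unfolding g_def using ex by (rule LeastI_ex)
    with that have "real_of_code (q (ppair (str_code \<sigma>) (2 * k + 2))) < (1 / 2) ^ (2 * k + 1)"
      unfolding small_iff by blast
    moreover have "0 \<le> (1 / 2 :: real) ^ (2 * k)" by simp
    ultimately show ?thesis
      using q(2)[of \<sigma> "2 * k + 2"] unfolding pow abs_le_iff by linarith
  qed
  ultimately show ?thesis by blast
qed

section \<open>Random sequences of the thinned measure\<close>

lemma MLR_thin_live:
  assumes "X \<in> MLR thin_measure" shows "live X n"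
proof (rule ccontr)
  assume "\<not> live X n"
  then have 0: "measure thin_measure (cyl (X \<restriction> n)) = 0" by (simp add: measure_thin_cyl)
  \<comment> \<open>A constant test, with one null cylinder as every component.\<close>
  define W where "W = {x. psnd x = str_code (X \<restriction> n)}"
  have "\<exists>i. \<forall>m. ppair i (str_code (X \<restriction> m)) \<notin> W"
    using assms
  proof (rule thin.MLR_escape)
    show "ce_set W" unfolding W_def by (intro ce_set_dec computable_intros)
    have "{\<sigma>. ppair i (str_code \<sigma>) \<in> W} = {X \<restriction> n}" for i by (auto simp: W_def)
    then show "measure thin_measure (\<Union>\<sigma>\<in>{\<sigma>. ppair i (str_code \<sigma>) \<in> W}. cyl \<sigma>) \<le> (1 / 2) ^ i" for i
      by (simp add: 0)
  qed
  then show False by (auto simp: W_def)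
qed

text \<open>Otherwise \<open>X\<close> is the zero sequence. All its positions are free, so its
  initial segment of length \<open>i\<close> can serve as component \<open>i\<close> of a
  test.\<close>

lemma MLR_thin_lead:
  assumes "X \<in> MLR thin_measure" shows "\<exists>e. lead X e"
proof (rule ccontr)
  let ?O = "\<lambda>_ :: nat. False"
  assume "\<nexists>e. lead X e"
  then have X: "X = ?O"
    unfolding lead_def by (metis LeastI not_less_Least)
  define W where "W = {x. length (str_of (psnd x)) = pfst x \<and> (\<forall>j<pfst x. \<not> seq (psnd x) j)}"
  have W: "{\<sigma>. ppair i (str_code \<sigma>) \<in> W} = {?O \<restriction> i}" for i
    by (auto simp: W_def seq_str_code nth_restr intro!: nth_equalityI)
  have "\<exists>i. \<forall>m. ppair i (str_code (X \<restriction> m)) \<notin> W"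
    using assms
  proof (rule thin.MLR_escape)
    show "ce_set W" unfolding W_def by (intro ce_set_dec computable_intros)
    have "nfree ?O i = i" for i
      by (simp add: nfree_def free_def lead_def)
    with measure_thin_cyl_le[of ?O]
    show "measure thin_measure (\<Union>\<sigma>\<in>{\<sigma>. ppair i (str_code \<sigma>) \<in> W}. cyl \<sigma>) \<le> (1 / 2) ^ i" for i
      unfolding W by (metis SUP_insert UN_empty Un_empty_right)
  qed
  with W X show False by blast
qed

text \<open>The Levin-Schnorr argument: component \<open>i\<close> of the test collects the strings
  with a description at least \<open>i\<close> shorter than their number of free positions, and
  Kraft's inequality bounds its measure.\<close>

lemma K_deficiency:
  assumes "X \<in> MLR thin_measure" shows "\<exists>i. \<forall>n. nfree X n < K (X \<restriction> n) + i"
proof -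
  \<comment> \<open>\<open>nfree\<close> as a function of codes: a cylinder has measure at most
    \<open>1 / 2\<close> to the power of its rank, with equality if it is live.\<close>
  define rank where "rank c = nfree (seq c) (length (str_of c))" for c
  have rank: "rank (str_code (Y \<restriction> n)) = nfree Y n" for Y n
    unfolding rank_def str_of_str_code length_restr by (rule live_nfree_cong) (rule seq_restr)
  obtain f where f: "partrec f" "\<And>\<tau>. f (str_code \<tau>) = map_option str_code (univ_machine \<tau>)"
    and pf: "\<And>\<sigma> \<tau>. \<sigma> \<in> dom univ_machine \<Longrightarrow> \<tau> \<in> dom univ_machine \<Longrightarrow> prefix \<sigma> \<tau> \<Longrightarrow> \<sigma> = \<tau>"
    using prefix_free_univ_machine unfolding prefix_free_machine_def by blast
  obtain p where p: "\<And>x y. f x = Some y \<longleftrightarrow> (\<exists>s. kleene_T p x s \<and> pfst s = y)"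
    using Kleene_normal_form[OF f(1)] by blast
  define W where "W = {x. \<exists>w. kleene_T p (pfst w) (psnd w) \<and> pfst (psnd w) = psnd x \<and>
      length (str_of (pfst w)) + pfst x \<le> rank (psnd x)}"
  have W: "ppair i (str_code \<sigma>) \<in> W \<longleftrightarrow>
      (\<exists>\<tau>. univ_machine \<tau> = Some \<sigma> \<and> length \<tau> + i \<le> rank (str_code \<sigma>))" (is "?L \<longleftrightarrow> ?R") for i \<sigma>
  proof -
    have "?L \<longleftrightarrow> (\<exists>t. (\<exists>s. kleene_T p t s \<and> pfst s = str_code \<sigma>) \<and> length (str_of t) + i \<le> rank (str_code \<sigma>))"
      by (auto simp: W_def) (metis pfst_ppair psnd_ppair)
    also have "\<dots> \<longleftrightarrow> (\<exists>t. f t = Some (str_code \<sigma>) \<and> length (str_of t) + i \<le> rank (str_code \<sigma>))"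
      by (simp add: p)
    also have "\<dots> \<longleftrightarrow> (\<exists>\<tau>. f (str_code \<tau>) = Some (str_code \<sigma>) \<and> length \<tau> + i \<le> rank (str_code \<sigma>))"
      by (metis str_code_str_of str_of_str_code)
    also have "\<dots> \<longleftrightarrow> ?R"
      by (simp add: f(2))
    finally show ?thesis .
  qed
  have "\<exists>i. \<forall>n. ppair i (str_code (X \<restriction> n)) \<notin> W"
    using assms
  proof (rule thin.MLR_escape)
    show "ce_set W" unfolding W_def rank_def by (intro ce_set_ex computable_intros)
  next
    fix i
    \<comment> \<open>The cylinder described by \<open>str_of t\<close> if that description is short
      enough, else empty. Its measure is at most \<open>(1 / 2) ^ i\<close> times the coin measure
      of \<open>D t\<close>.\<close>
    define G where "G t = (\<Union>\<sigma>\<in>{\<sigma>. univ_machine (str_of t) = Some \<sigma> \<and>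
      length (str_of t) + i \<le> rank (str_code \<sigma>)}. cyl \<sigma>)" for t
    \<comment> \<open>The cylinders \<open>D t\<close> are disjoint, which is Kraft's inequality for the domain.\<close>
    define D where "D t = (if univ_machine (str_of t) = None then {} else cyl (str_of t))" for t
    have "(\<Union>\<sigma>\<in>{\<sigma>. ppair i (str_code \<sigma>) \<in> W}. cyl \<sigma>) = (\<Union>t. G t)"
      unfolding G_def W by (auto, metis str_of_str_code)
    then have "emeasure thin_measure (\<Union>\<sigma>\<in>{\<sigma>. ppair i (str_code \<sigma>) \<in> W}. cyl \<sigma>) = emeasure thin_measure (\<Union>t. G t)"
      by simp
    also have "\<dots> \<le> (\<Sum>t. emeasure thin_measure (G t))"
      by (intro emeasure_subadditive_countably) (auto simp: G_def)
    also have "\<dots> \<le> (\<Sum>t. ennreal ((1 / 2) ^ i) * emeasure coin (D t))"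
    proof (rule suminf_le)
      fix t
      show "emeasure thin_measure (G t) \<le> ennreal ((1 / 2) ^ i) * emeasure coin (D t)"
      proof (cases "\<exists>\<sigma>. univ_machine (str_of t) = Some \<sigma> \<and> length (str_of t) + i \<le> rank (str_code \<sigma>)")
        case True
        then obtain \<sigma> where \<sigma>: "univ_machine (str_of t) = Some \<sigma>" "length (str_of t) + i \<le> rank (str_code \<sigma>)"
          by blast
        then have "G t = cyl \<sigma>" "D t = cyl (str_of t)" by (auto simp: G_def D_def)
        moreover have "measure thin_measure (cyl \<sigma>) \<le> (1 / 2) ^ rank (str_code \<sigma>)"
          using measure_thin_cyl_le[of "seq (str_code \<sigma>)" "length \<sigma>"] by (simp add: restr_seq rank_def)
        moreover have "(1 / 2 :: real) ^ rank (str_code \<sigma>) \<le> (1 / 2) ^ (length (str_of t) + i)"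
          using \<sigma>(2) by (intro power_decreasing) auto
        ultimately show ?thesis
          by (simp add: thin.emeasure_eq_measure emeasure_coin_cyl ennreal_mult[symmetric] power_add mult.commute)
      next
        case False
        then have "G t = {}" unfolding G_def by blast
        then show ?thesis by simp
      qed
    qed auto
    also have "\<dots> = ennreal ((1 / 2) ^ i) * (\<Sum>t. emeasure coin (D t))"
      by (rule ennreal_suminf_cmult)
    also have "(\<Sum>t. emeasure coin (D t)) = emeasure coin (\<Union>t. D t)"
    proof (rule suminf_emeasure)
      show "disjoint_family D"
        unfolding disjoint_family_on_def
      proof (intro ballI impI)
        fix t u :: nat assume "t \<noteq> u"
        show "D t \<inter> D u = {}"
        proof (cases "univ_machine (str_of t) = None \<or> univ_machine (str_of u) = None")
          case False
          then have "\<not> prefix (str_of t) (str_of u)" "\<not> prefix (str_of u) (str_of t)"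
            using pf[of "str_of t" "str_of u"] pf[of "str_of u" "str_of t"] \<open>t \<noteq> u\<close> by auto
          then show ?thesis using cyl_disjoint by (simp add: D_def)
        qed (auto simp: D_def)
      qed
    qed (auto simp: D_def)
    also have "ennreal ((1 / 2) ^ i) * emeasure coin (\<Union>t. D t) \<le> ennreal ((1 / 2) ^ i) * 1"
      by (intro mult_left_mono coin.emeasure_le_1) simp
    finally show "measure thin_measure (\<Union>\<sigma>\<in>{\<sigma>. ppair i (str_code \<sigma>) \<in> W}. cyl \<sigma>) \<le> (1 / 2) ^ i"
      by (simp add: thin.emeasure_eq_measure)
  qed
  then obtain i where i: "\<And>n. ppair i (str_code (X \<restriction> n)) \<notin> W" by blast
  have "nfree X n < K (X \<restriction> n) + i" for n
  proof -
    obtain \<tau> where "length \<tau> = K (X \<restriction> n)" "univ_machine \<tau> = Some (X \<restriction> n)"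
      using K_attained by blast
    with i[of n] show ?thesis unfolding W rank by (metis not_le)
  qed
  then show ?thesis by blast
qed

section \<open>Atoms, and complexity of the other random sequences\<close>

lemma atom_if_level_bounded:
  assumes "lead X e" "\<And>n. live X n" "\<And>n. level e n \<le> b"
  shows "X \<in> Atoms thin_measure"
proof -
  have "(1 / 2) ^ (Suc e + b) \<le> measure thin_measure {X}"
  proof (rule thin.le_measure_singleton[of "Suc e"])
    fix n assume "Suc e \<le> n"
    then have "nfree X n \<le> Suc e + b" using nfree_lead[OF assms(1), of n] assms(3)[of n] by simp
    then show "(1 / 2) ^ (Suc e + b) \<le> measure thin_measure (cyl (X \<restriction> n))"
      using assms(2) by (simp add: measure_thin_cyl del: power_Suc)
  qed
  moreover have "0 < (1 / 2 :: real) ^ (Suc e + b)" by simp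
  ultimately show ?thesis unfolding Atoms_def by (simp only: mem_Collect_eq)
qed

lemma not_atom_if_level_unbounded:
  assumes "lead X e" "\<And>k. \<exists>n. k \<le> level e n" shows "X \<notin> Atoms thin_measure"
proof
  assume "X \<in> Atoms thin_measure"
  then have "0 < measure thin_measure {X}" by (simp add: Atoms_def)
  then obtain k where k: "(1 / 2) ^ k < measure thin_measure {X}"
    using real_arch_pow_inv[of "measure thin_measure {X}" "1 / 2"] by auto
  obtain n where n: "k \<le> level e n" using assms(2) by blast
  have "level e n \<le> level e (n + Suc e)" using mono_level by (rule monoD) simp
  then have "k \<le> nfree X (n + Suc e)" using n nfree_lead[OF assms(1), of "n + Suc e"] by simp
  have "measure thin_measure {X} \<le> (1 / 2) ^ nfree X (n + Suc e)"
    using thin.measure_singleton_le measure_thin_cyl_le by (rule order_trans)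
  also have "\<dots> \<le> (1 / 2) ^ k"
    using \<open>k \<le> nfree X (n + Suc e)\<close> by (intro power_decreasing) auto
  finally show False using k by simp
qed

lemma lead_singleton: "lead (\<lambda>i. i = e) e"
  by (simp add: lead_def)

lemma live_singleton: "live (\<lambda>i. i = e) n"
  unfolding live_def by (simp add: free_lead[OF lead_singleton])

text \<open>A program of the nowhere defined function has no splits, so the mass of its cone rests
  on the sequence whose only 1 is at \<open>e\<close>.\<close>

lemma atomic_thin_measure: "atomic_measure thin_measure"
proof -
  have "partrec (\<lambda>_. None)"
    using partrec_Least[where A = "\<lambda>_ _. False", OF decidable_const] by simp
  then obtain e where "\<And>x s. \<not> kleene_T e x s"
    using Kleene_normal_form[of "\<lambda>_. None"] by auto
  then have "level e n = 0" for n
    unfolding level_eq_card by (simp add: splits_def splits_if_def)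
  then have "(\<lambda>i. i = e) \<in> Atoms thin_measure"
    by (intro atom_if_level_bounded[of _ e 0] live_singleton lead_singleton) simp
  then show ?thesis by (auto simp: atomic_measure_def)
qed

text \<open>Since \<open>X\<close> is no atom, its cone has unboundedly many splits. The order is
  \<open>level e\<close> lowered by the randomness deficiency \<open>i\<close>; truncated
  subtraction keeps \<open>f 0 = 0\<close>. Both \<open>e\<close> and \<open>i\<close> depend on
  \<open>X\<close>.\<close>

lemma complex_if_MLR_thin:
  assumes "X \<in> MLR thin_measure" "X \<notin> Atoms thin_measure" shows "complex_seq X"
proof -
  obtain e where e: "lead X e" using MLR_thin_lead[OF assms(1)] ..
  obtain i where i: "\<And>n. nfree X n < K (X \<restriction> n) + i" using K_deficiency[OF assms(1)] by blast
  have unbounded: "\<exists>n. k \<le> level e n" for k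
    using atom_if_level_bounded[OF e MLR_thin_live[OF assms(1)], of k] assms(2) by (meson nat_le_linear)
  define f where "f n = level e n - i" for n
  have "computable f" unfolding f_def by (intro computable_intros)
  moreover have "order_fun f"
    unfolding order_fun_def
  proof (intro conjI allI)
    show "mono f" unfolding f_def using mono_level by (auto simp: mono_def intro: diff_le_mono)
    show "\<exists>n. m \<le> f n" for m
      using unbounded[of "m + i"] unfolding f_def by (meson le_diff_conv2 le_add2 order_trans add_le_imp_le_diff)
  qed (simp add: f_def)
  moreover have "f n \<le> K (X \<restriction> n)" for n
  proof -
    have "level e n \<le> nfree X n"
    proof (cases "e < n")
      case False
      then have none: "{i. i < n \<and> splits e i} = {}" using splits_gt[of e] by force
      show ?thesis unfolding level_eq_card none by simp
    qed (simp add: nfree_lead[OF e])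
    with i[of n] show ?thesis by (simp add: f_def)
  qed
  ultimately show ?thesis unfolding complex_seq_def by blast
qed

section \<open>A cone that defeats a given continuous measure\<close>

lemma level_crossing: "k < level e n \<Longrightarrow> \<exists>i<n. level e i = k \<and> splits e i"
proof (induction n)
  case (Suc n)
  show ?case
  proof (cases "k < level e n")
    case True
    with Suc.IH show ?thesis by (meson less_SucI)
  next
    case False
    with Suc.prems have "splits e n" "level e n = k" by (auto simp: level_Suc split: if_splits)
    then show ?thesis by blast
  qed
qed simp

lemma level_unbounded:
  assumes "\<And>k. \<exists>s. kleene_T e k s" shows "\<exists>n. k \<le> level e n"
proof (induction k)
  case (Suc k)
  then obtain n where n: "k \<le> level e n" by blast
  obtain s where s: "kleene_T e k s" using assms by blast
  \<comment> \<open>The padding moves the certificate \<open>s\<close> to a position beyond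
    \<open>n\<close> and far enough for a split. There the level either has passed \<open>k\<close>
    already or rises from \<open>k\<close>.\<close>
  define i where "i = ppair (n + pfst s + Suc e) s"
  have i: "n + pfst s + Suc e \<le> i" unfolding i_def by (rule le_prod_encode_1)
  then have le: "k \<le> level e i" using n monoD[OF mono_level, of n i e] by linarith
  show ?case
  proof (cases "level e i = k")
    case True
    then have "splits e i" using s i by (simp add: splits_def splits_if_def i_def)
    then show ?thesis using True by (intro exI[of _ "Suc i"]) (simp add: level_Suc)
  next
    case False
    with le show ?thesis by (intro exI[of _ i]) simp
  qed
qed auto

text \<open>A live string in the cone has a 1 at \<open>e\<close> and otherwise only at splits, so
  the set of splits where its bit is 1 determines it.\<close>

lemma card_live_cone:
  fixes n e defines "A \<equiv> {\<sigma>. length \<sigma> = n \<and> live (seq (str_code \<sigma>)) n \<and> lead (seq (str_code \<sigma>)) e}"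
  shows "finite A" "card A \<le> 2 ^ level e n"
proof -
  let ?S = "{i. i < n \<and> splits e i}"
  let ?h = "\<lambda>\<sigma>. {i \<in> ?S. \<sigma> ! i}"
  have nth: "\<sigma> ! i \<longleftrightarrow> i = e \<or> i \<in> ?h \<sigma>" if "\<sigma> \<in> A" "i < n" for \<sigma> i
  proof -
    let ?X = "seq (str_code \<sigma>)"
    have X: "live ?X n" "lead ?X e" "?X i = \<sigma> ! i"
      using that by (simp_all add: A_def seq_str_code)
    then have "\<sigma> ! i \<Longrightarrow> i \<le> e \<or> splits e i"
      using that(2) free_lead[OF X(2)] by (auto simp: live_def)
    moreover have "i < e \<Longrightarrow> \<not> \<sigma> ! i" "i = e \<Longrightarrow> \<sigma> ! i"
      using X(2,3) by (auto simp: lead_def)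
    ultimately show ?thesis using that(2) splits_gt[of e i] by auto
  qed
  have "inj_on ?h A"
  proof (rule inj_onI)
    fix \<sigma> \<tau> assume *: "\<sigma> \<in> A" "\<tau> \<in> A" "?h \<sigma> = ?h \<tau>"
    then have len: "length \<sigma> = n" "length \<tau> = n" by (simp_all add: A_def)
    have "\<sigma> ! i = \<tau> ! i" if "i < n" for i
    proof -
      have "\<sigma> ! i \<longleftrightarrow> i = e \<or> i \<in> ?h \<sigma>" using *(1) that by (rule nth)
      also have "\<dots> \<longleftrightarrow> i = e \<or> i \<in> ?h \<tau>" by (simp only: *(3))
      also have "\<dots> \<longleftrightarrow> \<tau> ! i" using nth[OF *(2) that] by (rule sym)
      finally show ?thesis .
    qed
    with len show "\<sigma> = \<tau>" by (intro nth_equalityI) simp_all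
  qed
  moreover have "?h ` A \<subseteq> Pow ?S" "finite (Pow ?S)" by auto
  ultimately show "finite A" "card A \<le> 2 ^ level e n"
    using inj_on_finite[of ?h A "Pow ?S"] card_inj_on_le[of ?h A "Pow ?S"]
    by (simp_all add: card_Pow level_eq_card)
qed

text \<open>The cone has positive measure, whereas the sequences that are not random lie in a null
  set.\<close>

lemma MLR_thin_cone: "\<exists>X \<in> MLR thin_measure. lead X e"
proof (rule ccontr)
  let ?C = "cyl ((\<lambda>i. i = e) \<restriction> Suc e)"
  assume none: "\<not> ?thesis"
  obtain N where N: "N \<in> null_sets thin_measure" "- MLR thin_measure \<subseteq> N"
    using thin.MLR_conull by blast
  have "?C \<subseteq> N"
  proof
    fix X assume "X \<in> ?C"
    then have "lead X e"
      using lead_cong[of e X "\<lambda>i. i = e"] lead_singleton[of e] by (simp add: cyl_restr)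
    with none N(2) show "X \<in> N" by blast
  qed
  then have "?C \<in> null_sets thin_measure"
    by (intro null_sets_subset[OF N(1)]) simp_all
  then have "measure thin_measure ?C = 0"
    by (simp add: null_sets_def measure_def)
  moreover have "0 < measure thin_measure ?C"
    by (simp add: measure_thin_cyl live_singleton)
  ultimately show False by simp
qed

text \<open>Split number \<open>k\<close>, counted from 0, cannot come before
  \<open>g k + Suc e\<close>, so at most \<open>2 ^ k\<close> live strings of that length lie in the
  cone, each of measure at most \<open>(1 / 2) ^ (2 * k)\<close>. Together they form a test for
  \<nu> that captures \<open>X\<close>.\<close>

lemma not_MLR_in_cone:
  assumes "borel_prob \<nu>" "computable g"
    and g: "\<And>k \<sigma>. length \<sigma> = g k \<Longrightarrow> measure \<nu> (cyl \<sigma>) \<le> (1 / 2) ^ (2 * k)"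
    and e: "\<And>k s. kleene_T e k s \<Longrightarrow> pfst s = g k"
    and X: "lead X e" "\<And>n. live X n"
  shows "X \<notin> MLR \<nu>"
proof
  interpret cantor_prob \<nu> using assms(1) by (simp add: cantor_prob_iff)
  assume "X \<in> MLR \<nu>"
  \<comment> \<open>The summand \<open>Suc e\<close> matches the bound in \<open>splits_if\<close>
    and makes the strings long enough to show the 1 at \<open>e\<close>.\<close>
  define n where "n k = g k + Suc e" for k
  define W where "W = {x. length (str_of (psnd x)) = n (pfst x) \<and> live (seq (psnd x)) (n (pfst x)) \<and>
    (seq (psnd x) e \<and> (\<forall>i<e. \<not> seq (psnd x) i))}"
  have W: "ppair k (str_code \<sigma>) \<in> W \<longleftrightarrow>
      length \<sigma> = n k \<and> live (seq (str_code \<sigma>)) (n k) \<and> lead (seq (str_code \<sigma>)) e" for k \<sigma>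
    by (simp add: W_def lead_def)
  have "\<exists>k. \<forall>m. ppair k (str_code (X \<restriction> m)) \<notin> W"
    using \<open>X \<in> MLR \<nu>\<close>
  proof (rule MLR_escape)
    have "computable n" unfolding n_def by (intro computable_intros assms(2))
    then show "ce_set W"
      unfolding W_def by (intro ce_set_dec computable_intros computable_comp[OF \<open>computable n\<close>])
  next
    fix k
    let ?A = "{\<sigma>. ppair k (str_code \<sigma>) \<in> W}"
    have level: "level e (n k) \<le> k"
    proof (rule ccontr)
      assume "\<not> level e (n k) \<le> k"
      then obtain i where "i < n k" "level e i = k" "splits e i"
        using level_crossing[of k e "n k"] by auto
      then show False using e[of k "psnd i"] by (auto simp: splits_def splits_if_def n_def)
    qed
    have A: "finite ?A" "card ?A \<le> 2 ^ level e (n k)"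
      unfolding W using card_live_cone by auto
    have small: "measure \<nu> (cyl \<sigma>) \<le> (1 / 2) ^ (2 * k)" if "\<sigma> \<in> ?A" for \<sigma>
    proof -
      have "measure \<nu> (cyl \<sigma>) \<le> measure \<nu> (cyl (take (g k) \<sigma>))"
        by (intro finite_measure_mono cyl_prefix take_is_prefix) simp
      also have "\<dots> \<le> (1 / 2) ^ (2 * k)"
        using that by (intro g) (auto simp: W n_def)
      finally show ?thesis .
    qed
    have "measure \<nu> (\<Union>\<sigma>\<in>?A. cyl \<sigma>) \<le> (\<Sum>\<sigma>\<in>?A. measure \<nu> (cyl \<sigma>))"
      using A(1) by (intro finite_measure_subadditive_finite) auto
    also have "\<dots> \<le> real (card ?A) * (1 / 2) ^ (2 * k)"
      using small by (rule sum_bounded_above)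
    also have "\<dots> \<le> 2 ^ k * (1 / 2) ^ (2 * k)"
    proof (rule mult_right_mono)
      have "card ?A \<le> 2 ^ k" using A(2) level by (meson one_le_numeral order_trans power_increasing)
      then show "real (card ?A) \<le> 2 ^ k" by (metis of_nat_le_iff of_nat_numeral of_nat_power)
    qed simp
    also have "\<dots> = (1 / 2) ^ k"
      by (simp add: mult_2 power_add power_one_over)
    finally show "measure \<nu> (\<Union>\<sigma>\<in>?A. cyl \<sigma>) \<le> (1 / 2) ^ k" .
  qed
  moreover have "ppair k (str_code (X \<restriction> n k)) \<in> W" for k
  proof -
    have "live (seq (str_code (X \<restriction> n k))) (n k) = live X (n k)"
      by (rule live_nfree_cong) (rule seq_restr)
    moreover have "lead (seq (str_code (X \<restriction> n k))) e = lead X e"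
      by (rule lead_cong) (simp add: seq_restr n_def)
    ultimately show ?thesis using X by (simp add: W)
  qed
  ultimately show False by blast
qed

theorem theorem4p1:
  shows "\<exists>\<mu>. borel_prob \<mu> \<and> computable_measure \<mu> \<and> atomic_measure \<mu> \<and>
    (\<forall>X \<in> MLR \<mu> - Atoms \<mu>. complex_seq X) \<and>
    \<not> (\<exists>\<nu>. borel_prob \<nu> \<and> computable_measure \<nu> \<and> continuous_measure \<nu> \<and>
          MLR \<mu> - Atoms \<mu> \<subseteq> MLR \<nu>)"
proof (intro exI[of _ thin_measure] conjI ballI notI)
  show "borel_prob thin_measure" by (rule borel_prob_thin_measure)
  show "computable_measure thin_measure" by (rule computable_thin_measure)
  show "atomic_measure thin_measure" by (rule atomic_thin_measure)
  show "complex_seq X" if "X \<in> MLR thin_measure - Atoms thin_measure" for X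
    using that by (intro complex_if_MLR_thin) auto
  assume "\<exists>\<nu>. borel_prob \<nu> \<and> computable_measure \<nu> \<and> continuous_measure \<nu> \<and>
    MLR thin_measure - Atoms thin_measure \<subseteq> MLR \<nu>"
  then obtain \<nu> where \<nu>: "borel_prob \<nu>" "computable_measure \<nu>" "continuous_measure \<nu>"
    "MLR thin_measure - Atoms thin_measure \<subseteq> MLR \<nu>" by blast
  obtain g where g: "computable g"
    "\<And>k \<sigma>. length \<sigma> = g k \<Longrightarrow> measure \<nu> (cyl \<sigma>) \<le> (1 / 2) ^ (2 * k)"
    using computable_modulus[OF \<nu>(1-3)] by blast
  \<comment> \<open>A program for the modulus of \<nu>. It halts on every input, so its cone has
    unboundedly many splits and contains no atom.\<close>
  obtain e where e: "\<And>k s. kleene_T e k s \<Longrightarrow> pfst s = g k" "\<And>k. \<exists>s. kleene_T e k s"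
    using computable_index[OF g(1)] by blast
  obtain X where X: "X \<in> MLR thin_measure" "lead X e" using MLR_thin_cone by blast
  have "X \<notin> Atoms thin_measure"
    using X(2) level_unbounded[OF e(2)] by (rule not_atom_if_level_unbounded)
  moreover have "X \<notin> MLR \<nu>"
    using \<nu>(1) g e(1) X(2) MLR_thin_live[OF X(1)] by (rule not_MLR_in_cone)
  ultimately show False using X(1) \<nu>(4) by blast
qed

end
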